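(* Let $a\ge 1$ be an integer and let $X\subset\{1,\ldots,a\}^{\mathbb Z}$ be a closed shift-invariant set such that the symbolic system $(X,\sigma)$ has uniformly positive entropy (UPE). Then the hub-and-spoke system $(\operatorname{Spoke}(X),\sigma)$ has uniformly positive mean dimension (UPMD).
   Context: A topological dynamical system $(X,T)$ is a compact metrizable space $X$ with a homeomorphism $T:X\to X$. For a finite open cover $\mathcal U$ of $X$ put $\mathcal U_0^{n-1}=\bigvee_{i=0}^{n-1}T^{-i}\mathcal U$. Entropy of a cover: $h_{\mathrm{top}}(X,T,\mathcal U)=\lim_{n\to\infty}\frac1n\log\mathcal N(\mathcal U_0^{n-1})$, where $\mathcal N(\mathcal V)$ is the minimal cardinality of a subcover of $\mathcal V$. Mean dimension of a cover: let $\operatorname{ord}(\mathcal U)=\max_{x\in X}\#\{U\in\mathcal U: x\in U\}-1$ and $\mathcal D(\mathcal U)=\min\operatorname{ord}(\gamma)$, the minimum over all finite open covers $\gamma$ of $X$ refining $\mathcal U$. Then $\operatorname{mdim}(X,T,\mathcal U)=\lim_{n\to\infty}\mathcal D(\mathcal U_0^{n-1})/n$ (the limit exists by subadditivity). A standard open cover of $X$ is a two-element open cover $\{U,V\}$ such that neither $U$ nor $V$ is dense in $X$. The system $(X,T)$ has UPE if $h_{\mathrm{top}}(X,T,\mathcal U)>0$ for every standard open cover $\mathcal U$ of $X$; it has UPMD if $\operatorname{mdim}(X,T,\mathcal U)>0$ for every standard open cover $\mathcal U$ of $X$. Shift. On any sequence space $A^{\mathbb Z}$, $\sigma$ is the left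 shift $(\sigma x)_m=x_{m+1}$. Hub-and-spoke system. Let $\overline{\mathbb D}$ be the closed unit disk in $\mathbb R^2$ and fix distinct points $p_1,\ldots,p_a\in\partial\mathbb D$. Define $\Phi:X\times[0,1]^{\mathbb Z}\to\overline{\mathbb D}^{\mathbb Z}$ by $\Phi(x,t)_i=t_i\,p_{x_i}$, and $\operatorname{Spoke}(X)=\Phi(X\times[0,1]^{\mathbb Z})$, a closed shift-invariant subset of $\overline{\mathbb D}^{\mathbb Z}$ (product topology). *)

theory Defs
  imports "HOL-Analysis.Analysis"
begin

definition tds :: "'a topology \<Rightarrow> ('a \<Rightarrow> 'a) \<Rightarrow> bool" where
  "tds X T \<longleftrightarrow> compact_space X \<and> metrizable_space X \<and> homeomorphic_map X X T"

definition finite_open_cover :: "'a topology \<Rightarrow> 'a set set \<Rightarrow> bool" where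
  "finite_open_cover X \<U> \<longleftrightarrow> finite \<U> \<and> (\<forall>U\<in>\<U>. openin X U) \<and> \<Union>\<U> = topspace X"

definition refines_cover :: "'a set set \<Rightarrow> 'a set set \<Rightarrow> bool" where
  "refines_cover \<V> \<U> \<longleftrightarrow> (\<forall>V\<in>\<V>. \<exists>U\<in>\<U>. V \<subseteq> U)"

definition join_cover :: "'a set set \<Rightarrow> 'a set set \<Rightarrow> 'a set set" where
  "join_cover \<U> \<V> = {U \<inter> V |U V. U \<in> \<U> \<and> V \<in> \<V>}"

definition preimage_cover :: "'a topology \<Rightarrow> ('a \<Rightarrow> 'a) \<Rightarrow> 'a set set \<Rightarrow> 'a set set" where
  "preimage_cover X f \<U> = {{x \<in> topspace X. f x \<in> U} |U. U \<in> \<U>}"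

text \<open>The join of the pullbacks of \<open>\<U>\<close> under \<open>T ^^ i\<close> for \<open>i < n\<close>;
  the empty join is the trivial cover.\<close>

primrec iter_cover :: "'a topology \<Rightarrow> ('a \<Rightarrow> 'a) \<Rightarrow> 'a set set \<Rightarrow> nat \<Rightarrow> 'a set set" where
  "iter_cover X T \<U> 0 = {topspace X}"
| "iter_cover X T \<U> (Suc n) =
     join_cover (iter_cover X T \<U> n) (preimage_cover X (T ^^ n) \<U>)"

definition min_subcover_card :: "'a topology \<Rightarrow> 'a set set \<Rightarrow> nat" where
  "min_subcover_card X \<V> =
     (LEAST k. \<exists>\<W>. \<W> \<subseteq> \<V> \<and> finite \<W> \<and> topspace X \<subseteq> \<Union>\<W> \<and> card \<W> = k)"

definition htop_cover :: "'a topology \<Rightarrow> ('a \<Rightarrow> 'a) \<Rightarrow> 'a set set \<Rightarrow> real" where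
  "htop_cover X T \<U> = lim (\<lambda>n. ln (real (min_subcover_card X (iter_cover X T \<U> n))) / real n)"

text \<open>For a finite cover of a nonempty space the maximum is over a finite nonempty set of
  positive numbers, so the subtraction on \<^typ>\<open>nat\<close> does not truncate.  On the empty space the
  value is a junk value, but the empty space has no standard open cover.\<close>

definition cover_ord :: "'a topology \<Rightarrow> 'a set set \<Rightarrow> nat" where
  "cover_ord X \<U> = Max ((\<lambda>x. card {U \<in> \<U>. x \<in> U}) ` topspace X) - 1"

definition cover_dim :: "'a topology \<Rightarrow> 'a set set \<Rightarrow> nat" where
  "cover_dim X \<U> =
     (LEAST k. \<exists>\<gamma>. finite_open_cover X \<gamma> \<and> refines_cover \<gamma> \<U> \<and> cover_ord X \<gamma> = k)"

definition mdim_cover :: "'a topology \<Rightarrow> ('a \<Rightarrow> 'a) \<Rightarrow> 'a set set \<Rightarrow> real" where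
  "mdim_cover X T \<U> = lim (\<lambda>n. real (cover_dim X (iter_cover X T \<U> n)) / real n)"

definition standard_open_cover :: "'a topology \<Rightarrow> 'a set set \<Rightarrow> bool" where
  "standard_open_cover X \<U> \<longleftrightarrow>
     finite_open_cover X \<U> \<and> card \<U> = 2 \<and> (\<forall>U\<in>\<U>. X closure_of U \<noteq> topspace X)"

definition UPE :: "'a topology \<Rightarrow> ('a \<Rightarrow> 'a) \<Rightarrow> bool" where
  "UPE X T \<longleftrightarrow> tds X T \<and> (\<forall>\<U>. standard_open_cover X \<U> \<longrightarrow> htop_cover X T \<U> > 0)"

definition UPMD :: "'a topology \<Rightarrow> ('a \<Rightarrow> 'a) \<Rightarrow> bool" where
  "UPMD X T \<longleftrightarrow> tds X T \<and> (\<forall>\<U>. standard_open_cover X \<U> \<longrightarrow> mdim_cover X T \<U> > 0)"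

definition shift :: "(int \<Rightarrow> 'a) \<Rightarrow> int \<Rightarrow> 'a" where
  "shift x = (\<lambda>m. x (m + 1))"

definition hub_map :: "(nat \<Rightarrow> real ^ 2) \<Rightarrow> (int \<Rightarrow> nat) \<Rightarrow> (int \<Rightarrow> real) \<Rightarrow> int \<Rightarrow> real ^ 2" where
  "hub_map p x t = (\<lambda>i. t i *\<^sub>R p (x i))"

definition Spoke :: "(nat \<Rightarrow> real ^ 2) \<Rightarrow> (int \<Rightarrow> nat) set \<Rightarrow> (int \<Rightarrow> real ^ 2) set" where
  "Spoke p X = {hub_map p x t |x t. x \<in> X \<and> (\<forall>i. t i \<in> {0..1})}"

end

theory Submission
  imports Defs
begin

text \<open>
  The idea is to find, inside \<open>Spoke p X\<close>, cubes of dimension proportional to \<open>n\<close> on which the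
  \<open>n\<close>-th join of the given cover \<open>{U, V}\<close> separates every pair of opposite faces. By the Lebesgue
  covering theorem such a join has dimension at least that of the cube.

  As \<open>U\<close> and \<open>V\<close> are not dense, there are points \<open>u\<close> and \<open>v\<close> of \<open>Spoke p X\<close> and a window
  \<open>{-N..N}\<close> such that no point agreeing with \<open>u\<close> on the window lies in \<open>U\<close>, and no point agreeing
  with \<open>v\<close> lies in \<open>V\<close>. Let \<open>x\<close>, \<open>y\<close> be the symbolic sequences below \<open>u\<close>, \<open>v\<close>. Suppose the words
  of \<open>x\<close> and \<open>y\<close> on the window are independent along a set \<open>J\<close> of times: for each way of choosing
  one of the two words at every time in \<open>J\<close>, some point of \<open>X\<close> shows the chosen words. After
  thinning \<open>J\<close> so that the windows are disjoint, a coordinate \<open>r \<in> [0,1]\<close> for each time in \<open>J\<close>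
  moves the window from that of \<open>u\<close> (\<open>r = 0\<close>) through the hub \<open>0\<close> (\<open>r = 1/2\<close>) to that of \<open>v\<close>
  (\<open>r = 1\<close>). The symbol only changes while the radius vanishes, so the path stays in \<open>Spoke p X\<close>;
  independence allows all coordinates to move freely. This is \<open>cube_through_hub\<close>.

  Independence along sets of positive density comes from positive entropy of the cover of \<open>X\<close> by the
  complements of the two cylinders. A Sauer-Shelah argument for partially defined patterns
  (\<open>avoiding_patterns\<close>) shows that if only small sets of times are independent, then subexponentially
  many members of the iterated cover suffice, so that the entropy would be zero
  (\<open>positive_entropy_shatters\<close>). If the two words coincide, there is no such cover, and it suffices that
  the word occurs with positive density; this is deduced from the case of different words in
  \<open>UPE_independence\<close>.

  The dimension bound is \<open>cube_covering\<close>, which follows from the Sperner-Kuhn lemma. Finally, mean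
  dimension is a limit, and the bound is obtained for infinitely many \<open>n\<close> only; so one needs
  that the limit exists. This is Fekete's lemma, based on the inequality \<open>cover_dim_join_le\<close>, which
  is proved by slicing functions that describe the two covers at a common height.
\<close>

section \<open>Shattering and avoiding binary patterns\<close>

text \<open>A point \<open>s\<close> is viewed as a partial binary pattern: it has value 1 at \<open>i\<close> if \<open>P s i\<close>, value 0 if
  \<open>Q s i\<close>, and is undefined at \<open>i\<close> otherwise. Shattering demands that every total pattern on \<open>J\<close> is
  realised.\<close>

definition shattered :: "'s set \<Rightarrow> ('s \<Rightarrow> 'i \<Rightarrow> bool) \<Rightarrow> ('s \<Rightarrow> 'i \<Rightarrow> bool) \<Rightarrow> 'i set \<Rightarrow> bool" where
  "shattered S P Q J \<longleftrightarrow> (\<forall>\<omega>\<subseteq>J. \<exists>s\<in>S. \<forall>i\<in>J. if i \<in> \<omega> then P s i else Q s i)"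

lemma shatteredD:
  "shattered S P Q J \<Longrightarrow> \<omega> \<subseteq> J \<Longrightarrow> \<exists>s\<in>S. \<forall>i\<in>J. if i \<in> \<omega> then P s i else Q s i"
  unfolding shattered_def by simp

text \<open>The total pattern \<open>\<omega>\<close> differs from \<open>s\<close> wherever \<open>s\<close> is defined. In the application this means
  that a point lies in the member of an iterated two-set cover that is labelled by \<open>\<omega>\<close>.\<close>

definition avoids :: "('s \<Rightarrow> 'i \<Rightarrow> bool) \<Rightarrow> ('s \<Rightarrow> 'i \<Rightarrow> bool) \<Rightarrow> 'i set \<Rightarrow> 's \<Rightarrow> 'i set \<Rightarrow> bool" where
  "avoids P Q I s \<omega> \<longleftrightarrow> (\<forall>i\<in>I. if i \<in> \<omega> then \<not> P s i else \<not> Q s i)"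

lemma avoids_insert_in:
  "avoids P Q I s \<omega> \<Longrightarrow> \<not> P s z \<Longrightarrow> avoids P Q (insert z I) s (insert z \<omega>)"
  unfolding avoids_def by auto

lemma avoids_insert_notin:
  "avoids P Q I s \<omega> \<Longrightarrow> \<not> Q s z \<Longrightarrow> z \<notin> \<omega> \<Longrightarrow> avoids P Q (insert z I) s \<omega>"
  unfolding avoids_def by auto

lemma shattered_mono: "shattered S P Q J \<Longrightarrow> S \<subseteq> S' \<Longrightarrow> shattered S' P Q J"
  unfolding shattered_def by (meson subsetD)

lemma shattered_empty_iff: "shattered S P Q {} \<longleftrightarrow> S \<noteq> {}"
  unfolding shattered_def by auto

lemma shattered_insert:
  assumes "shattered {s\<in>S. P s z} P Q J" and "shattered {s\<in>S. Q s z} P Q J" and "z \<notin> J"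
  shows "shattered S P Q (insert z J)"
  unfolding shattered_def
proof (intro allI impI)
  fix \<omega> assume "\<omega> \<subseteq> insert z J"
  then have *: "\<omega> - {z} \<subseteq> J" by auto
  show "\<exists>s\<in>S. \<forall>i\<in>insert z J. if i \<in> \<omega> then P s i else Q s i"
  proof (cases "z \<in> \<omega>")
    case True
    from assms(1) * obtain s where "s \<in> S" "P s z" "\<forall>i\<in>J. if i \<in> \<omega> - {z} then P s i else Q s i"
      unfolding shattered_def by blast
    with True \<open>z \<notin> J\<close> show ?thesis by (intro bexI[of _ s]) (auto split: if_splits)
  next
    case False
    from assms(2) * obtain s where "s \<in> S" "Q s z" "\<forall>i\<in>J. if i \<in> \<omega> - {z} then P s i else Q s i"
      unfolding shattered_def by blast
    with False \<open>z \<notin> J\<close> show ?thesis by (intro bexI[of _ s]) (auto split: if_splits)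
  qed
qed

text \<open>Fixing the value at a new coordinate \<open>z\<close> splits the shattered sets: a set that is shattered by
  both halves yields, in addition to itself, the set with \<open>z\<close> adjoined. Hence one of the two halves
  shatters at most half as many sets as the whole.\<close>

lemma card_shattered_split:
  assumes "finite I" and "z \<notin> I"
  shows "card {J. J \<subseteq> I \<and> shattered {s\<in>S. P s z} P Q J} +
         card {J. J \<subseteq> I \<and> shattered {s\<in>S. Q s z} P Q J}
         \<le> card {J. J \<subseteq> insert z I \<and> shattered S P Q J}" (is "card ?A + card ?B \<le> card ?C")
proof -
  have fin: "finite ?A" "finite ?B" "finite ?C" using assms(1) by auto
  have "card ?A + card ?B = card (?A \<union> ?B) + card (?A \<inter> ?B)"
    using card_Un_Int fin by blast
  also have "card (?A \<inter> ?B) = card (insert z ` (?A \<inter> ?B))"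
  proof (rule card_image[symmetric], rule inj_onI)
    fix J K assume "J \<in> ?A \<inter> ?B" "K \<in> ?A \<inter> ?B" "insert z J = insert z K"
    moreover from this have "z \<notin> J" "z \<notin> K" using assms(2) by blast+
    ultimately show "J = K" by (simp add: insert_ident)
  qed
  also have "card (?A \<union> ?B) + card (insert z ` (?A \<inter> ?B)) = card ((?A \<union> ?B) \<union> insert z ` (?A \<inter> ?B))"
    by (rule card_Un_disjoint[symmetric]) (use fin assms(2) in auto)
  also have "\<dots> \<le> card ?C"
  proof (rule card_mono[OF fin(3)])
    have "?A \<union> ?B \<subseteq> ?C"
      using shattered_mono[of "{s\<in>S. P s z}" P Q _ S] shattered_mono[of "{s\<in>S. Q s z}" P Q _ S]
      by blast
    moreover have "insert z ` (?A \<inter> ?B) \<subseteq> ?C"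
      using shattered_insert[of S P z Q] assms(2) by blast
    ultimately show "(?A \<union> ?B) \<union> insert z ` (?A \<inter> ?B) \<subseteq> ?C" by blast
  qed
  finally show ?thesis .
qed

lemma sum_choose_Suc:
  "(\<Sum>i<Suc m. Suc n choose i) = (\<Sum>i<m. n choose i) + (\<Sum>i<Suc m. n choose i)"
  by (simp only: sum.lessThan_Suc_shift) (simp add: sum.distrib)

text \<open>A bound for the number of patterns needed so that each partial pattern is avoided by one of them.
  Go through the coordinates and bet at each that the value is not the one whose half shatters fewer
  sets. When the bet is lost, the number of shattered sets has dropped by a factor 2, so fewer
  than \<open>m\<close> bets are lost, and the set of lost bets determines the pattern. In the induction, the first
  summand of \<open>sum_choose_Suc\<close> counts the patterns for a lost bet, the second those for a won bet.\<close>

lemma avoiding_patterns: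
  fixes P Q :: "'s \<Rightarrow> 'i \<Rightarrow> bool"
  assumes "finite I" and "\<forall>s\<in>S. \<forall>i\<in>I. \<not> (P s i \<and> Q s i)"
    and "card {J. J \<subseteq> I \<and> shattered S P Q J} < 2 ^ m"
  shows "\<exists>\<Omega>. \<Omega> \<subseteq> Pow I \<and> card \<Omega> \<le> (\<Sum>i<m. card I choose i) \<and>
           (\<forall>s\<in>S. \<exists>\<omega>\<in>\<Omega>. avoids P Q I s \<omega>)"
  using assms
proof (induction I arbitrary: S m rule: finite_induct)
  case empty
  show ?case
  proof (cases "S = {}")
    case True
    then show ?thesis by (intro exI[of _ "{}"]) auto
  next
    case False
    then have "{J. J \<subseteq> {} \<and> shattered S P Q J} = {{}}"
      by (auto simp: shattered_empty_iff)
    with empty have "m \<noteq> 0" by (intro notI) auto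
    then obtain m' where "m = Suc m'" by (cases m) auto
    then have "1 \<le> (\<Sum>i<m. (0::nat) choose i)"
      by (simp add: sum.lessThan_Suc_shift del: sum.lessThan_Suc)
    then show ?thesis by (intro exI[of _ "{{}}"]) (auto simp: avoids_def)
  qed
next
  case (insert z I)
  let ?sh = "\<lambda>I S. card {J. J \<subseteq> I \<and> shattered S P Q J}"
  let ?good = "\<lambda>I S \<Omega>. \<forall>s\<in>S. \<exists>\<omega>\<in>\<Omega>. avoids P Q I s \<omega>"
  let ?S1 = "{s\<in>S. P s z}" and ?S0 = "{s\<in>S. Q s z}"
  have IH: "\<exists>\<Omega>\<subseteq>Pow I. card \<Omega> \<le> (\<Sum>i<k. card I choose i) \<and> ?good I R \<Omega>"
    if "\<forall>s\<in>R. \<forall>i\<in>I. \<not> (P s i \<and> Q s i)" "?sh I R < 2 ^ k" for R k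
    using insert.IH[of R k] that by simp
  have disj: "\<not> (P s i \<and> Q s i)" if "s \<in> S" "i \<in> insert z I" for s i
    using insert.prems(1) that by blast
  have split: "?sh I ?S1 + ?sh I ?S0 \<le> ?sh (insert z I) S"
    by (rule card_shattered_split) (use insert in auto)
  have mono: "?sh I R < 2 ^ m" if "R \<subseteq> S" for R
  proof -
    have "?sh I R \<le> ?sh (insert z I) S"
      by (rule card_mono) (use insert.hyps(1) that shattered_mono[of R P Q _ S] in auto)
    with insert.prems(2) show ?thesis by simp
  qed
  show ?case
  proof (cases m)
    case 0
    with insert.prems(2) insert.hyps(1) have "{J. J \<subseteq> insert z I \<and> shattered S P Q J} = {}"
      by (simp add: card_eq_0_iff)
    then have "\<not> shattered S P Q {}" by blast
    then have "S = {}" by (simp add: shattered_empty_iff)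
    then show ?thesis by (intro exI[of _ "{}"]) auto
  next
    case (Suc m')
    have bound: "card (\<Omega> \<union> \<Omega>') \<le> (\<Sum>i<m. card (insert z I) choose i)"
      if "card \<Omega> \<le> (\<Sum>i<m'. card I choose i)" "card \<Omega>' \<le> (\<Sum>i<m. card I choose i)" for \<Omega> \<Omega>' :: "'i set set"
    proof -
      have "card (\<Omega> \<union> \<Omega>') \<le> card \<Omega> + card \<Omega>'" by (rule card_Un_le)
      also have "\<dots> \<le> (\<Sum>i<m. Suc (card I) choose i)"
        using that unfolding Suc sum_choose_Suc by simp
      finally show ?thesis using insert.hyps by simp
    qed
    have image: "card (insert z ` \<Omega>) \<le> card \<Omega>" if "\<Omega> \<subseteq> Pow I" for \<Omega>
      by (rule card_image_le) (use that insert.hyps(1) in \<open>auto intro: finite_subset\<close>)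
    \<comment> \<open>the half that shatters fewer sets is bet against\<close>
    consider "?sh I ?S1 < 2 ^ m'" | "?sh I ?S0 < 2 ^ m'"
      using split insert.prems(2) unfolding Suc power_Suc by linarith
    then show ?thesis
    proof cases
      case 1
      have "\<forall>s\<in>?S1. \<forall>i\<in>I. \<not> (P s i \<and> Q s i)"
        by (intro ballI disj) auto
      from IH[OF this 1] obtain \<Omega>1 where
        1: "\<Omega>1 \<subseteq> Pow I" "card \<Omega>1 \<le> (\<Sum>i<m'. card I choose i)" "?good I ?S1 \<Omega>1"
        by (elim exE conjE) (erule (2) that)
      have "\<forall>s\<in>S - ?S1. \<forall>i\<in>I. \<not> (P s i \<and> Q s i)"
        by (intro ballI disj) auto
      from IH[OF this mono[OF Diff_subset]] obtain \<Omega>2 where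
        2: "\<Omega>2 \<subseteq> Pow I" "card \<Omega>2 \<le> (\<Sum>i<m. card I choose i)" "?good I (S - ?S1) \<Omega>2"
        by (elim exE conjE) (erule (2) that)
      have "?good (insert z I) S (\<Omega>1 \<union> insert z ` \<Omega>2)"
      proof
        fix s assume s: "s \<in> S"
        show "\<exists>\<omega>\<in>\<Omega>1 \<union> insert z ` \<Omega>2. avoids P Q (insert z I) s \<omega>"
        proof (cases "P s z")
          case True
          with 1(3) s obtain \<omega> where w: "\<omega> \<in> \<Omega>1" "avoids P Q I s \<omega>" by blast
          have "z \<notin> \<omega>" using w(1) 1(1) insert.hyps(2) by blast
          then have "avoids P Q (insert z I) s \<omega>"
            using w(2) True disj[OF s, of z] by (intro avoids_insert_notin) auto
          then show ?thesis using w(1) by blast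
        next
          case False
          with 2(3) s obtain \<omega> where w: "\<omega> \<in> \<Omega>2" "avoids P Q I s \<omega>" by blast
          have "avoids P Q (insert z I) s (insert z \<omega>)"
            using w(2) False by (intro avoids_insert_in) auto
          then show ?thesis using w(1) by blast
        qed
      qed
      moreover have "card (\<Omega>1 \<union> insert z ` \<Omega>2) \<le> (\<Sum>i<m. card (insert z I) choose i)"
        by (rule bound[OF 1(2) order_trans[OF image[OF 2(1)] 2(2)]])
      moreover have "\<Omega>1 \<union> insert z ` \<Omega>2 \<subseteq> Pow (insert z I)"
        using 1(1) 2(1) by (auto simp: subset_insertI2)
      ultimately show ?thesis by (intro exI conjI)
    next
      case 2
      have "\<forall>s\<in>?S0. \<forall>i\<in>I. \<not> (P s i \<and> Q s i)"
        by (intro ballI disj) auto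
      from IH[OF this 2] obtain \<Omega>1 where
        1: "\<Omega>1 \<subseteq> Pow I" "card \<Omega>1 \<le> (\<Sum>i<m'. card I choose i)" "?good I ?S0 \<Omega>1"
        by (elim exE conjE) (erule (2) that)
      have "\<forall>s\<in>S - ?S0. \<forall>i\<in>I. \<not> (P s i \<and> Q s i)"
        by (intro ballI disj) auto
      from IH[OF this mono[OF Diff_subset]] obtain \<Omega>2 where
        2: "\<Omega>2 \<subseteq> Pow I" "card \<Omega>2 \<le> (\<Sum>i<m. card I choose i)" "?good I (S - ?S0) \<Omega>2"
        by (elim exE conjE) (erule (2) that)
      have "?good (insert z I) S (insert z ` \<Omega>1 \<union> \<Omega>2)"
      proof
        fix s assume s: "s \<in> S"
        show "\<exists>\<omega>\<in>insert z ` \<Omega>1 \<union> \<Omega>2. avoids P Q (insert z I) s \<omega>"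
        proof (cases "Q s z")
          case True
          with 1(3) s obtain \<omega> where w: "\<omega> \<in> \<Omega>1" "avoids P Q I s \<omega>" by blast
          have "avoids P Q (insert z I) s (insert z \<omega>)"
            using w(2) True disj[OF s, of z] by (intro avoids_insert_in) auto
          then show ?thesis using w(1) by blast
        next
          case False
          with 2(3) s obtain \<omega> where w: "\<omega> \<in> \<Omega>2" "avoids P Q I s \<omega>" by blast
          have "z \<notin> \<omega>" using w(1) 2(1) insert.hyps(2) by blast
          then have "avoids P Q (insert z I) s \<omega>"
            using w(2) False by (intro avoids_insert_notin) auto
          then show ?thesis using w(1) by blast
        qed
      qed
      moreover have "card (insert z ` \<Omega>1 \<union> \<Omega>2) \<le> (\<Sum>i<m. card (insert z I) choose i)"
        by (rule bound[OF order_trans[OF image[OF 1(1)] 1(2)] 2(2)])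
      moreover have "insert z ` \<Omega>1 \<union> \<Omega>2 \<subseteq> Pow (insert z I)"
        using 1(1) 2(1) by (auto simp: subset_insertI2)
      ultimately show ?thesis by (intro exI conjI)
    qed
  qed
qed

text \<open>Chernoff's bound: \<open>y ^ d\<close> times the sum is at most \<open>(1 + y) ^ n \<le> exp (y * n)\<close> for \<open>0 < y \<le> 1\<close>.
  Choose \<open>y\<close> of order \<open>\<epsilon>\<close> first and then \<open>c\<close> so small that \<open>y powr (- c)\<close> is close to 1.\<close>

lemma binomial_tail_le_exp:
  fixes \<epsilon> :: real
  assumes "\<epsilon> > 0"
  shows "\<exists>c>0. \<forall>n d. real d \<le> c * real n \<longrightarrow> real (\<Sum>i\<le>d. n choose i) \<le> exp (\<epsilon> * real n)"
proof -
  define y where "y = min 1 (\<epsilon> / 2)"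
  define L where "L = ln (1 / y)"
  define c where "c = \<epsilon> / (2 * (1 + L))"
  have y: "0 < y" "y \<le> 1" "y \<le> \<epsilon> / 2" unfolding y_def using assms by auto
  have L: "0 \<le> L" unfolding L_def using y by simp
  have c: "c > 0" unfolding c_def using assms L by (intro divide_pos_pos) auto
  have cL: "c * L \<le> \<epsilon> / 2" unfolding c_def using L assms by (simp add: field_simps)
  have "real (\<Sum>i\<le>d. n choose i) \<le> exp (\<epsilon> * real n)" if d: "real d \<le> c * real n" for n d
  proof -
    have "real (\<Sum>i\<le>d. n choose i) * y ^ d = (\<Sum>i\<le>d. real (n choose i) * y ^ d)"
      by (simp add: sum_distrib_right)
    also have "\<dots> \<le> (\<Sum>i\<le>d. real (n choose i) * y ^ i)"
      using y by (intro sum_mono mult_left_mono power_decreasing) auto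
    also have "\<dots> \<le> (\<Sum>i\<le>max d n. real (n choose i) * y ^ i)"
      using y by (intro sum_mono2) auto
    also have "\<dots> = (\<Sum>i\<le>n. real (n choose i) * y ^ i)"
      by (rule sum.mono_neutral_right) auto
    also have "\<dots> = (y + 1) ^ n"
      using binomial_ring[of y 1 n] by simp
    also have "\<dots> \<le> exp y ^ n"
      using y by (intro power_mono) (auto simp: add.commute[of y])
    also have "\<dots> \<le> exp (\<epsilon> / 2 * real n)"
      using mult_right_mono[OF y(3), of "real n"] by (simp add: exp_of_nat2_mult[symmetric])
    finally have 1: "real (\<Sum>i\<le>d. n choose i) * y ^ d \<le> exp (\<epsilon> / 2 * real n)" .
    have "(1 / y) ^ d = exp (real d * L)"
      unfolding L_def using y by (simp add: exp_of_nat_mult)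
    also have "real d * L \<le> c * real n * L"
      using d L by (rule mult_right_mono)
    also have "\<dots> = c * L * real n" by simp
    also have "\<dots> \<le> \<epsilon> / 2 * real n" using cL by (rule mult_right_mono) simp
    finally have 2: "(1 / y) ^ d \<le> exp (\<epsilon> / 2 * real n)" by simp
    have "real (\<Sum>i\<le>d. n choose i) = (real (\<Sum>i\<le>d. n choose i) * y ^ d) * (1 / y) ^ d"
      using y by (simp add: power_one_over)
    also have "\<dots> \<le> exp (\<epsilon> / 2 * real n) * exp (\<epsilon> / 2 * real n)"
      using 1 2 y by (intro mult_mono) auto
    also have "\<dots> = exp (\<epsilon> * real n)" by (simp flip: exp_add)
    finally show ?thesis .
  qed
  with c show ?thesis by blast
qed

lemma card_small_subsets:
  assumes "finite I"
  shows "card {J. J \<subseteq> I \<and> card J \<le> d} = (\<Sum>i\<le>d. card I choose i)"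
proof -
  have "{J. J \<subseteq> I \<and> card J \<le> d} = (\<Union>i\<le>d. {J. J \<subseteq> I \<and> card J = i})" by auto
  also have "card \<dots> = (\<Sum>i\<le>d. card {J. J \<subseteq> I \<and> card J = i})"
    by (rule card_UN_disjoint) (use assms in auto)
  finally show ?thesis using assms by (simp add: n_subsets)
qed

text \<open>If only sets of size at most \<open>c * n\<close> are shattered, then there are few shattered sets, and the
  logarithm of their number, which bounds the number of lost bets, is again a small multiple
  of \<open>n\<close>. Hence the binomial estimate is applied twice.\<close>

lemma few_avoiding_patterns:
  fixes \<epsilon> :: real
  assumes "\<epsilon> > 0"
  shows "\<exists>c>0. \<forall>n (S::'s set) P Q. (\<forall>s\<in>S. \<forall>i<n. \<not> (P s i \<and> Q s i)) \<longrightarrow>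
      (\<forall>J\<subseteq>{..<n}. shattered S P Q J \<longrightarrow> real (card J) \<le> c * real n) \<longrightarrow>
      (\<exists>\<Omega>\<subseteq>Pow {..<n}. real (card \<Omega>) \<le> exp (\<epsilon> * real n) \<and>
         (\<forall>s\<in>S. \<exists>\<omega>\<in>\<Omega>. avoids P Q {..<n} s \<omega>))"
proof -
  obtain c2 where c2: "c2 > 0" "\<And>n d. real d \<le> c2 * real n \<Longrightarrow> real (\<Sum>i\<le>d. n choose i) \<le> exp (\<epsilon> * real n)"
    using binomial_tail_le_exp[OF assms] by blast
  have "ln 2 * c2 > 0" using c2 by simp
  then obtain c1 where c1: "c1 > 0"
    "\<And>n d. real d \<le> c1 * real n \<Longrightarrow> real (\<Sum>i\<le>d. n choose i) \<le> exp (ln 2 * c2 * real n)"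
    using binomial_tail_le_exp by blast
  have main: "\<exists>\<Omega>\<subseteq>Pow {..<n}. real (card \<Omega>) \<le> exp (\<epsilon> * real n) \<and>
         (\<forall>s\<in>S. \<exists>\<omega>\<in>\<Omega>. avoids P Q {..<n} s \<omega>)"
    if disj: "\<forall>s\<in>S. \<forall>i<n. \<not> (P s i \<and> Q s i)"
      and small: "\<forall>J\<subseteq>{..<n}. shattered S P Q J \<longrightarrow> real (card J) \<le> c1 * real n"
    for n and S :: "'s set" and P Q
  proof -
    define d where "d = nat \<lfloor>c1 * real n\<rfloor>"
    define m where "m = nat \<lfloor>c2 * real n\<rfloor>"
    have d: "real d \<le> c1 * real n" unfolding d_def using c1(1) by simp
    have m: "real m \<le> c2 * real n" unfolding m_def using c2(1) by simp
    \<comment> \<open>one more than the integer part, so that \<open>2 ^ Suc m\<close> exceeds the number of shattered sets\<close>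
    have m': "c2 * real n < real (Suc m)" unfolding m_def by linarith
    let ?sh = "{J. J \<subseteq> {..<n} \<and> shattered S P Q J}"
    have "?sh \<subseteq> {J. J \<subseteq> {..<n} \<and> card J \<le> d}"
      using small unfolding d_def by (auto simp: le_nat_floor)
    then have "card ?sh \<le> (\<Sum>i\<le>d. n choose i)"
      using card_mono[of "{J. J \<subseteq> {..<n} \<and> card J \<le> d}" ?sh] card_small_subsets[of "{..<n}" d] by simp
    then have "real (card ?sh) \<le> exp (ln 2 * c2 * real n)"
      using c1(2)[OF d] by linarith
    also have "\<dots> < exp (ln 2 * real (Suc m))"
      using m' by (simp add: mult.assoc del: of_nat_Suc)
    also have "\<dots> = 2 ^ Suc m"
      by (simp add: mult.commute[of "ln 2"] exp_of_nat_mult del: of_nat_Suc)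
    finally have "card ?sh < 2 ^ Suc m" by (simp flip: of_nat_less_iff[where 'a=real])
    from avoiding_patterns[OF _ _ this] disj obtain \<Omega> where
      O: "\<Omega> \<subseteq> Pow {..<n}" "card \<Omega> \<le> (\<Sum>i<Suc m. n choose i)"
      "\<forall>s\<in>S. \<exists>\<omega>\<in>\<Omega>. avoids P Q {..<n} s \<omega>" by auto
    have "real (card \<Omega>) \<le> exp (\<epsilon> * real n)"
      using O(2) c2(2)[OF m] unfolding lessThan_Suc_atMost by linarith
    with O show ?thesis by (intro exI[of _ \<Omega>]) auto
  qed
  show ?thesis
    by (intro exI[of _ c1] conjI allI impI c1(1)) (erule (1) main)
qed

lemma shattered_subset:
  assumes "shattered S P Q J" and "J' \<subseteq> J"
  shows "shattered S P Q J'"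
  unfolding shattered_def
proof (intro allI impI)
  fix \<omega> assume "\<omega> \<subseteq> J'"
  then have "\<omega> \<subseteq> J" using assms(2) by simp
  then obtain s where "s \<in> S" "\<forall>i\<in>J. if i \<in> \<omega> then P s i else Q s i"
    using assms(1) unfolding shattered_def by meson
  then show "\<exists>s\<in>S. \<forall>i\<in>J'. if i \<in> \<omega> then P s i else Q s i"
    using assms(2) by (intro bexI[of _ s] ballI) (simp_all add: subset_iff)
qed

definition shatters_positive_density :: "'s set \<Rightarrow> ('s \<Rightarrow> nat \<Rightarrow> bool) \<Rightarrow> ('s \<Rightarrow> nat \<Rightarrow> bool) \<Rightarrow> bool" where
  "shatters_positive_density S P Q \<longleftrightarrow>
     (\<exists>c>0. \<exists>\<^sub>F n in sequentially. \<exists>J\<subseteq>{..<n}. c * real n \<le> real (card J) \<and> shattered S P Q J)"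

lemma shatters_positive_density_mono:
  assumes "\<And>J. shattered S P Q J \<Longrightarrow> shattered S P' Q' J" and "shatters_positive_density S P Q"
  shows "shatters_positive_density S P' Q'"
proof -
  obtain c where c: "c > 0"
    "\<exists>\<^sub>F n in sequentially. \<exists>J\<subseteq>{..<n}. c * real n \<le> real (card J) \<and> shattered S P Q J"
    using assms(2) unfolding shatters_positive_density_def by (elim exE conjE) (erule (1) that)
  have "\<exists>\<^sub>F n in sequentially. \<exists>J\<subseteq>{..<n}. c * real n \<le> real (card J) \<and> shattered S P' Q' J"
    using c(2)
  proof (rule frequently_elim1)
    fix n assume "\<exists>J\<subseteq>{..<n}. c * real n \<le> real (card J) \<and> shattered S P Q J"
    then show "\<exists>J\<subseteq>{..<n}. c * real n \<le> real (card J) \<and> shattered S P' Q' J"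
      by (elim exE conjE) (intro exI conjI, assumption+, erule assms(1))
  qed
  with c(1) show ?thesis
    unfolding shatters_positive_density_def by (intro exI[of _ c] conjI)
qed

text \<open>Some residue class modulo \<open>M\<close> contains at least the average share of \<open>J\<close>.\<close>

lemma separated_subset:
  fixes J :: "nat set"
  assumes "finite J" and "M > 0"
  shows "\<exists>J'\<subseteq>J. card J \<le> M * card J' \<and> (\<forall>i\<in>J'. \<forall>j\<in>J'. i \<noteq> j \<longrightarrow> int M \<le> \<bar>int i - int j\<bar>)"
proof -
  let ?R = "\<lambda>r. {j\<in>J. j mod M = r}"
  have "J = (\<Union>r<M. ?R r)" using assms(2) by auto
  then have "card J = card (\<Union>r<M. ?R r)" by simp
  also have "\<dots> \<le> (\<Sum>r<M. card (?R r))" by (rule card_UN_le) simp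
  finally have le: "card J \<le> (\<Sum>r<M. card (?R r))" .
  have "\<exists>r<M. card J \<le> M * card (?R r)"
  proof (rule ccontr)
    assume "\<not> ?thesis"
    then have less: "M * card (?R r) < card J" if "r < M" for r using that by (simp add: not_le)
    have "M * card J \<le> M * (\<Sum>r<M. card (?R r))" using le by simp
    also have "\<dots> = (\<Sum>r<M. M * card (?R r))" by (rule sum_distrib_left)
    also have "\<dots> < (\<Sum>r<M. card J)"
      by (rule sum_strict_mono) (use assms(2) less in auto)
    finally show False by simp
  qed
  then obtain r where r: "card J \<le> M * card (?R r)" by blast
  have "int M \<le> \<bar>int i - int j\<bar>" if "i \<in> ?R r" "j \<in> ?R r" "i \<noteq> j" for i j
  proof -
    have "int i mod int M = int j mod int M" using that by (simp flip: zmod_int)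
    then have "int M dvd int i - int j" by (simp add: mod_eq_dvd_iff)
    then show ?thesis using that(3) by (intro zdvd_imp_le[of "int M" "\<bar>int i - int j\<bar>"]) auto
  qed
  then show ?thesis using r by (intro exI[of _ "?R r"]) auto
qed

section \<open>The Lebesgue covering theorem for cubes\<close>

text \<open>All cubes are represented in the same space of sequences, a \<open>k\<close>-dimensional one by its first \<open>k\<close>
  coordinates, so that the dimension can be an ordinary variable.\<close>

definition hilbert_cube :: "(nat \<Rightarrow> real) set" where
  "hilbert_cube = {q. \<forall>i. q i \<in> {0..1}}"

lemma compact_box:
  fixes a b :: real
  shows "compact {t :: 'i \<Rightarrow> real. \<forall>i. t i \<in> {a..b}}"
proof -
  have "compactin (product_topology (\<lambda>i::'i. euclidean) UNIV) (PiE UNIV (\<lambda>_. {a..b}))"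
    by (simp add: compactin_PiE compactin_euclidean_iff)
  moreover have "PiE UNIV (\<lambda>_. {a..b}) = {t :: 'i \<Rightarrow> real. \<forall>i. t i \<in> {a..b}}"
    by (auto simp: PiE_def Pi_def)
  ultimately show ?thesis
    by (metis compactin_euclidean_iff euclidean_product_topology)
qed

lemma dist_fun_le_of_coordinatewise:
  fixes x y :: "'i::countable \<Rightarrow> 'a::metric_space"
  assumes "\<And>i. dist (x i) (y i) \<le> e"
  shows "dist x y \<le> 2 * e + (1/2) ^ N"
proof -
  have eq: "{dist (x (from_nat n)) (y (from_nat n)) |n. n \<le> N}
      = (\<lambda>n. dist (x (from_nat n)) (y (from_nat n))) ` {..N}"
    by (simp only: setcompr_eq_image atMost_def)
  have "Max ((\<lambda>n. dist (x (from_nat n)) (y (from_nat n))) ` {..N}) \<le> e"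
  proof (rule Max.boundedI)
    show "z \<le> e" if "z \<in> (\<lambda>n. dist (x (from_nat n)) (y (from_nat n))) ` {..N}" for z
      using that by (elim imageE) (simp only: assms)
  qed simp_all
  with dist_fun_le_dist_first_terms[of x y N] show ?thesis unfolding eq by linarith
qed

text \<open>The colouring \<open>f\<close> takes \<open>k + 1\<close> values and factors through \<open>g\<close>.\<close>

lemma card_ge_of_all_colours:
  assumes "f ` S = {..k::nat}" and "finite I" and "g ` S \<subseteq> I" and "\<And>x y. x \<in> S \<Longrightarrow> y \<in> S \<Longrightarrow> g x = g y \<Longrightarrow> f x = f y"
  shows "k + 1 \<le> card (g ` S)"
proof -
  define s where "s = inv_into S f"
  have s: "s j \<in> S \<and> f (s j) = j" if "j \<le> k" for j
  proof -
    have "j \<in> f ` S" using assms(1) that by simp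
    then show ?thesis unfolding s_def by (simp add: inv_into_into f_inv_into_f)
  qed
  have "inj_on (g \<circ> s) {..k}"
    by (rule inj_onI) (metis assms(4) atMost_iff comp_apply s)
  moreover have "(g \<circ> s) ` {..k} \<subseteq> g ` S" using s by auto
  moreover have "finite (g ` S)" using assms(2,3) finite_subset by blast
  ultimately have "card {..k} \<le> card (g ` S)" by (rule card_inj_on_le)
  then show ?thesis by simp
qed

text \<open>Triangulate a fine grid in the cube and let each grid point choose a member \<open>g x\<close> of the cover
  that contains a whole ball about it. Labelling the point by the set of lower faces which that
  member meets satisfies the boundary conditions of the Sperner-Kuhn lemma. So some small simplex
  has vertices of \<open>k + 1\<close> different reduced labels. As the label depends on \<open>g x\<close> only, the vertices
  chose \<open>k + 1\<close> different members, and all of these contain every vertex of the simplex.\<close>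

theorem cube_covering:
  fixes G :: "'i \<Rightarrow> (nat \<Rightarrow> real) set"
  assumes "finite I" and "\<And>i. i \<in> I \<Longrightarrow> open (G i)" and "hilbert_cube \<subseteq> (\<Union>i\<in>I. G i)"
    and faces: "\<And>i m x y. i \<in> I \<Longrightarrow> m < k \<Longrightarrow> x \<in> G i \<inter> hilbert_cube \<Longrightarrow> y \<in> G i \<inter> hilbert_cube \<Longrightarrow>
        x m = 0 \<Longrightarrow> y m = 1 \<Longrightarrow> False"
  shows "\<exists>q\<in>hilbert_cube. k + 1 \<le> card {i\<in>I. q \<in> G i}"
proof -
  have "compact hilbert_cube" unfolding hilbert_cube_def by (rule compact_box)
  then obtain e where e: "e > 0" "\<And>x. x \<in> hilbert_cube \<Longrightarrow> \<exists>U\<in>G ` I. ball x e \<subseteq> U"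
    using Heine_Borel_lemma[of hilbert_cube "G ` I"] assms(2,3) by blast
  obtain N where N: "(1/2) ^ N < e / 2"
    using real_arch_pow_inv[of "e/2" "1/2"] e(1) by auto
  \<comment> \<open>mesh size \<open>1 / p\<close>: the first \<open>N\<close> coordinates and the tail contribute less than \<open>e / 2\<close> each\<close>
  obtain p :: nat where p: "real p > 4 / e" using reals_Archimedean2 by blast
  then have "real p > 0" using e(1) by (smt (verit) divide_pos_pos)
  then have p0: "p > 0" by simp
  have pe: "2 * (1 / real p) < e / 2" using p e(1) p0 by (simp add: field_simps)
  define pt where "pt x = (\<lambda>j. real (x j) / real p)" for x :: "nat \<Rightarrow> nat"
  have pt: "pt x \<in> hilbert_cube" if "\<And>j. x j \<le> p" for x
    using that p0 unfolding pt_def hilbert_cube_def by (auto simp: divide_le_eq)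
  have "\<forall>x. \<exists>i. (\<forall>j. x j \<le> p) \<longrightarrow> i \<in> I \<and> ball (pt x) e \<subseteq> G i"
    using e(2) pt by blast
  then obtain g where g: "\<And>x. (\<forall>j. x j \<le> p) \<Longrightarrow> g x \<in> I \<and> ball (pt x) e \<subseteq> G (g x)"
    by metis
  define lab :: "(nat \<Rightarrow> nat) \<Rightarrow> nat \<Rightarrow> nat" where
    "lab x m = (if \<exists>q\<in>G (g x) \<inter> hilbert_cube. q m = 0 then 0 else 1)" for x m
  have in_G: "pt x \<in> G (g x)" if "\<forall>j. x j \<le> p" for x
    using g[OF that] e(1) by (meson centre_in_ball subsetD)
  have lab0: "lab x j = 0" if "\<forall>j. x j \<le> p" "x j = 0" for x j
  proof -
    have "pt x \<in> G (g x) \<inter> hilbert_cube" using in_G pt that by blast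
    moreover have "pt x j = 0" using that(2) unfolding pt_def by simp
    ultimately show ?thesis unfolding lab_def by auto
  qed
  have lab1: "lab x j = 1" if "\<forall>j. x j \<le> p" "j < k" "x j = p" for x j
  proof -
    have "pt x \<in> G (g x) \<inter> hilbert_cube" using in_G pt that by blast
    moreover have "pt x j = 1" using that(3) p0 unfolding pt_def by simp
    ultimately have "\<not> (\<exists>q\<in>G (g x) \<inter> hilbert_cube. q j = 0)"
      using faces[of "g x" j _ "pt x"] g[OF that(1)] that(2) by blast
    then show ?thesis unfolding lab_def by auto
  qed
  have "odd (card {s. ksimplex p k s \<and> (reduced k \<circ> lab) ` s = {..k}})"
    by (rule kuhn_combinatorial[OF p0]) (use lab0 lab1 in blast)+
  then obtain s where "ksimplex p k s" and full: "(reduced k \<circ> lab) ` s = {..k}"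
    by (metis (mono_tags, lifting) Collect_empty_eq card.empty even_zero)
  from \<open>ksimplex p k s\<close> obtain base upd where "kuhn_simplex p k base upd s"
    by (auto elim: ksimplex.cases)
  then interpret kuhn_simplex p k base upd s .
  have le_p: "\<forall>j. a j \<le> p" if "a \<in> s" for a using s_le_p[OF that] by blast
  have "s \<noteq> {}" using full by auto
  then obtain b where b: "b \<in> s" by blast
  have "pt b \<in> G (g a)" if "a \<in> s" for a
  proof -
    have "dist (pt a j) (pt b j) \<le> 1 / real p" for j
    proof -
      have "a j \<le> Suc (b j)" "b j \<le> Suc (a j)"
        using base_le[OF that, of j] base_le[OF b, of j] le_Suc_base[OF that, of j] le_Suc_base[OF b, of j]
        by auto
      then have "\<bar>real (a j) - real (b j)\<bar> \<le> 1" by linarith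
      moreover have "dist (pt a j) (pt b j) = \<bar>real (a j) - real (b j)\<bar> / real p"
        unfolding pt_def dist_real_def by (simp flip: diff_divide_distrib)
      ultimately show ?thesis by (simp add: divide_right_mono)
    qed
    then have "dist (pt a) (pt b) \<le> 2 * (1 / real p) + (1/2) ^ N"
      by (rule dist_fun_le_of_coordinatewise)
    then have "pt b \<in> ball (pt a) e" using pe N by simp
    then show ?thesis using g[OF le_p[OF that]] by blast
  qed
  then have "g ` s \<subseteq> {i\<in>I. pt b \<in> G i}" using g le_p by blast
  moreover have "k + 1 \<le> card (g ` s)"
  proof (rule card_ge_of_all_colours[OF full \<open>finite I\<close>])
    show "g ` s \<subseteq> I" using g le_p by blast
    show "(reduced k \<circ> lab) x = (reduced k \<circ> lab) y" if "g x = g y" for x y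
    proof -
      have "lab x = lab y" unfolding lab_def using that by simp
      then show ?thesis by simp
    qed
  qed
  ultimately have "k + 1 \<le> card {i\<in>I. pt b \<in> G i}"
    using card_mono[of "{i\<in>I. pt b \<in> G i}" "g ` s"] \<open>finite I\<close> by simp
  moreover have "pt b \<in> hilbert_cube" using pt le_p[OF b] by blast
  ultimately show ?thesis by blast
qed

section \<open>The dimension of a cover and its subadditivity\<close>

lemma cover_dim_le_cover_ord:
  "finite_open_cover X \<gamma> \<Longrightarrow> refines_cover \<gamma> \<U> \<Longrightarrow> cover_dim X \<U> \<le> cover_ord X \<gamma>"
  unfolding cover_dim_def by (rule Least_le) blast

lemma cover_dim_attained:
  assumes "finite_open_cover X \<U>"
  obtains \<gamma> where "finite_open_cover X \<gamma>" "refines_cover \<gamma> \<U>" "cover_ord X \<gamma> = cover_dim X \<U>"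
proof -
  have "\<exists>k \<gamma>. finite_open_cover X \<gamma> \<and> refines_cover \<gamma> \<U> \<and> cover_ord X \<gamma> = k"
    using assms unfolding refines_cover_def by blast
  from LeastI_ex[OF this] show ?thesis
    unfolding cover_dim_def[symmetric] using that by blast
qed

lemma finite_cover_multiplicities:
  assumes "finite \<gamma>"
  shows "finite ((\<lambda>x. card {U \<in> \<gamma>. x \<in> U}) ` A)"
  by (rule finite_subset[of _ "{..card \<gamma>}"]) (use assms in \<open>auto intro: card_mono\<close>)

lemma card_le_cover_ord:
  assumes "finite \<gamma>" and "x \<in> topspace X"
  shows "card {U \<in> \<gamma>. x \<in> U} \<le> cover_ord X \<gamma> + 1"
proof -
  have "card {U \<in> \<gamma>. x \<in> U} \<le> Max ((\<lambda>x. card {U \<in> \<gamma>. x \<in> U}) ` topspace X)"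
    by (rule Max_ge) (use assms finite_cover_multiplicities in auto)
  then show ?thesis unfolding cover_ord_def by linarith
qed

lemma cover_ord_le:
  assumes "finite \<gamma>" and "topspace X \<noteq> {}"
    and "\<And>x. x \<in> topspace X \<Longrightarrow> card {U \<in> \<gamma>. x \<in> U} \<le> k + 1"
  shows "cover_ord X \<gamma> \<le> k"
proof -
  have "Max ((\<lambda>x. card {U \<in> \<gamma>. x \<in> U}) ` topspace X) \<le> k + 1"
    by (subst Max_le_iff) (use assms finite_cover_multiplicities in auto)
  then show ?thesis unfolding cover_ord_def by linarith
qed

text \<open>The distance to the complement detects membership in a relatively open set.\<close>

lemma positivity_function:
  fixes S :: "'a::metric_space set"
  assumes "openin (top_of_set S) A"
  shows "\<exists>f. continuous_on S f \<and> (\<forall>x\<in>S. (0::real) \<le> f x \<and> (x \<in> A \<longleftrightarrow> 0 < f x))"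
proof (cases "S - A = {}")
  case True
  then show ?thesis by (intro exI[of _ "\<lambda>_. 1"]) auto
next
  case False
  have "closedin (top_of_set S) (S - A)"
    using assms by (simp add: closedin_diff)
  then obtain K where K: "closed K" "S - A = S \<inter> K"
    by (auto simp: closedin_closed)
  have "x \<in> A \<longleftrightarrow> 0 < infdist x (S - A)" if "x \<in> S" for x
  proof -
    have "closure (S - A) \<subseteq> K" using K by (metis closure_minimal inf_le2)
    then have "x \<in> S - A \<longleftrightarrow> x \<in> closure (S - A)"
      using that K(2) closure_subset[of "S - A"] by blast
    also have "\<dots> \<longleftrightarrow> infdist x (S - A) = 0"
      using False by (simp add: in_closure_iff_infdist_zero)
    finally show ?thesis using that infdist_nonneg[of x "S - A"] by auto
  qed
  then show ?thesis
    by (intro exI[of _ "\<lambda>x. infdist x (S - A)"]) (auto intro: continuous_intros infdist_nonneg)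
qed

text \<open>The points whose superlevel set \<open>{z \<in> Z. c < h z x}\<close> is \<open>L\<close> for some height \<open>c > 0\<close> that is
  different from all the values \<open>h z x\<close>; the last condition makes the set open.\<close>

definition level_set :: "'a set \<Rightarrow> 'z set \<Rightarrow> ('z \<Rightarrow> 'a \<Rightarrow> real) \<Rightarrow> 'z set \<Rightarrow> 'a set" where
  "level_set S Z h L = {x\<in>S. \<exists>c>0. \<forall>z\<in>Z. if z \<in> L then c < h z x else h z x < c}"

lemma openin_level_set:
  assumes "finite Z" and "\<And>z. z \<in> Z \<Longrightarrow> continuous_on S (h z)"
  shows "openin (top_of_set S) (level_set S Z h L)"
proof -
  let ?V = "\<lambda>c z. {x\<in>S. if z \<in> L then c < h z x else h z x < c}"
  have "openin (top_of_set S) (?V c z)" if "z \<in> Z" for c z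
  proof -
    have "?V c z = S \<inter> h z -` (if z \<in> L then {c<..} else {..<c})" by auto
    then show ?thesis
      using continuous_openin_preimage_gen[OF assms(2)[OF that], of "if z \<in> L then {c<..} else {..<c}"]
      by auto
  qed
  then have "openin (top_of_set S) ((\<Inter>z\<in>Z. ?V c z) \<inter> S)" for c
    using openin_INT[OF assms(1), of "top_of_set S"] by simp
  then have "openin (top_of_set S) (\<Union>c\<in>{0<..}. (\<Inter>z\<in>Z. ?V c z) \<inter> S)"
    by (intro openin_Union) auto
  also have "(\<Union>c\<in>{0<..}. (\<Inter>z\<in>Z. ?V c z) \<inter> S) = level_set S Z h L"
    unfolding level_set_def by auto
  finally show ?thesis .
qed

text \<open>The superlevel sets of one point form a chain, so they are determined by their size.\<close>

lemma level_set_chain: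
  assumes "x \<in> level_set S Z h L" and "x \<in> level_set S Z h M" and "L \<subseteq> Z" and "M \<subseteq> Z"
    and "finite Z" and "card L = card M"
  shows "L = M"
proof -
  obtain c where c: "\<And>z. z \<in> Z \<Longrightarrow> if z \<in> L then c < h z x else h z x < c"
    using assms(1) unfolding level_set_def by blast
  obtain d where d: "\<And>z. z \<in> Z \<Longrightarrow> if z \<in> M then d < h z x else h z x < d"
    using assms(2) unfolding level_set_def by blast
  have "L \<subseteq> M \<or> M \<subseteq> L"
  proof (cases "c \<le> d")
    case True
    have "M \<subseteq> L"
    proof
      fix z assume "z \<in> M"
      with c[of z] d[of z] True assms(4) show "z \<in> L" by (auto split: if_splits)
    qed
    then show ?thesis ..
  next
    case False
    have "L \<subseteq> M"
    proof
      fix z assume "z \<in> L"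
      with c[of z] d[of z] False assms(3) show "z \<in> M" by (auto split: if_splits)
    qed
    then show ?thesis ..
  qed
  then show ?thesis
    using assms(3-6) by (metis card_subset_eq finite_subset)
qed

text \<open>Take optimal refinements \<open>\<alpha>\<close> and \<open>\<beta>\<close> of the two covers and functions that are positive exactly
  on their members. Refine the join by the sets of points having \<open>L\<close> as a superlevel set, where \<open>L\<close>
  runs through the subsets of the disjoint union of \<open>\<alpha>\<close> and \<open>\<beta>\<close> that contain a member of each. If
  \<open>x\<close> lies in \<open>a\<close> members of \<open>\<alpha>\<close> and \<open>b\<close> members of \<open>\<beta>\<close>, then its superlevel sets of this kind form a
  chain with sizes between 2 and \<open>a + b\<close>. So \<open>x\<close> lies in at most
  \<open>a + b - 1 = (a - 1) + (b - 1) + 1\<close> of the new sets, which is the required order.\<close>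

theorem cover_dim_join_le:
  fixes S :: "'a::metric_space set"
  assumes "S \<noteq> {}"
    and U: "finite_open_cover (top_of_set S) \<U>" and V: "finite_open_cover (top_of_set S) \<V>"
  shows "cover_dim (top_of_set S) (join_cover \<U> \<V>)
         \<le> cover_dim (top_of_set S) \<U> + cover_dim (top_of_set S) \<V>"
proof -
  let ?X = "top_of_set S"
  obtain \<alpha> where a: "finite_open_cover ?X \<alpha>" "refines_cover \<alpha> \<U>" "cover_ord ?X \<alpha> = cover_dim ?X \<U>"
    using cover_dim_attained[OF U] .
  obtain \<beta> where b: "finite_open_cover ?X \<beta>" "refines_cover \<beta> \<V>" "cover_ord ?X \<beta> = cover_dim ?X \<V>"
    using cover_dim_attained[OF V] .
  have fin: "finite \<alpha>" "finite \<beta>" and cov: "\<Union>\<alpha> = S" "\<Union>\<beta> = S"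
    using a(1) b(1) unfolding finite_open_cover_def by auto
  define Z where "Z = \<alpha> <+> \<beta>"
  define set_of where "set_of = case_sum (\<lambda>A::'a set. A) (\<lambda>B. B)"
  have finZ: "finite Z" unfolding Z_def using fin by simp
  have "\<forall>z. \<exists>f. z \<in> Z \<longrightarrow> continuous_on S f \<and> (\<forall>x\<in>S. (0::real) \<le> f x \<and> (x \<in> set_of z \<longleftrightarrow> 0 < f x))"
  proof
    fix z
    have "openin ?X (set_of z)" if "z \<in> Z"
      using that a(1) b(1) unfolding Z_def set_of_def finite_open_cover_def by auto
    then show "\<exists>f. z \<in> Z \<longrightarrow> continuous_on S f \<and> (\<forall>x\<in>S. (0::real) \<le> f x \<and> (x \<in> set_of z \<longleftrightarrow> 0 < f x))"
      using positivity_function by blast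
  qed
  then obtain h where h: "\<And>z. z \<in> Z \<Longrightarrow> continuous_on S (h z)"
    "\<And>z x. z \<in> Z \<Longrightarrow> x \<in> S \<Longrightarrow> x \<in> set_of z \<longleftrightarrow> (0::real) < h z x"
    by metis
  define \<L> where "\<L> = {L. L \<subseteq> Z \<and> L \<inter> range Inl \<noteq> {} \<and> L \<inter> range Inr \<noteq> {}}"
  define \<gamma> where "\<gamma> = level_set S Z h ` \<L>"
  have finL: "finite \<L>" unfolding \<L>_def using finZ by simp
  have pos: "x \<in> set_of z" if "x \<in> level_set S Z h L" "z \<in> L" "L \<in> \<L>" for x z L
  proof -
    have "z \<in> Z" using that unfolding \<L>_def by blast
    moreover from this have "x \<in> S" "0 < h z x"
      using that(1,2) unfolding level_set_def by force+
    ultimately show ?thesis using h(2) by blast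
  qed
  have "refines_cover \<gamma> (join_cover \<U> \<V>)"
    unfolding refines_cover_def
  proof
    fix W assume "W \<in> \<gamma>"
    then obtain L where L: "W = level_set S Z h L" "L \<in> \<L>" unfolding \<gamma>_def by blast
    then obtain A B where AB: "Inl A \<in> L" "Inr B \<in> L" "A \<in> \<alpha>" "B \<in> \<beta>"
      unfolding \<L>_def Z_def by blast
    then obtain U V where UV: "U \<in> \<U>" "A \<subseteq> U" "V \<in> \<V>" "B \<subseteq> V"
      using a(2) b(2) unfolding refines_cover_def by meson
    have "W \<subseteq> A \<inter> B"
      using pos[OF _ AB(1) L(2)] pos[OF _ AB(2) L(2)] unfolding L(1) set_of_def by auto
    then have "W \<subseteq> U \<inter> V" using UV by blast
    then show "\<exists>U\<in>join_cover \<U> \<V>. W \<subseteq> U"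
      unfolding join_cover_def using UV by blast
  qed
  moreover have "finite_open_cover ?X \<gamma>"
    unfolding finite_open_cover_def
  proof (intro conjI ballI)
    show "finite \<gamma>" unfolding \<gamma>_def using finL by simp
    show "openin ?X W" if "W \<in> \<gamma>" for W
      using that openin_level_set[of Z S h, OF finZ h(1)] unfolding \<gamma>_def by blast
    have "x \<in> \<Union>\<gamma>" if "x \<in> S" for x
    proof -
      have "x \<in> \<Union>\<alpha>" "x \<in> \<Union>\<beta>" using cov that by simp_all
      then obtain A B where AB: "A \<in> \<alpha>" "x \<in> A" "B \<in> \<beta>" "x \<in> B" by blast
      then have mem: "Inl A \<in> Z" "Inr B \<in> Z" unfolding Z_def by auto
      define m where "m = min (h (Inl A) x) (h (Inr B) x)"
      have "m > 0" using h(2)[OF mem(1) that] h(2)[OF mem(2) that] AB unfolding m_def set_of_def by simp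
      \<comment> \<open>a height below both values that avoids the finitely many values at \<open>x\<close>\<close>
      then have "infinite ({0<..<m} - (\<lambda>z. h z x) ` Z)"
        using finZ by (simp add: Diff_infinite_finite infinite_Ioo)
      then have "{0<..<m} - (\<lambda>z. h z x) ` Z \<noteq> {}"
        by (metis finite.emptyI)
      then obtain c where "c \<in> {0<..<m} - (\<lambda>z. h z x) ` Z" by (auto simp only: ex_in_conv[symmetric])
      then have c: "0 < c" "c < m" "c \<notin> (\<lambda>z. h z x) ` Z" by simp_all
      define L where "L = {z\<in>Z. c < h z x}"
      have "Inl A \<in> L" "Inr B \<in> L" unfolding L_def using mem c(2) unfolding m_def by auto
      then have "L \<in> \<L>" unfolding \<L>_def L_def by blast
      moreover have "x \<in> level_set S Z h L"
        unfolding level_set_def L_def using that c(1,3) by (auto intro!: exI[of _ c] simp: not_less less_le)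
      ultimately show ?thesis unfolding \<gamma>_def by blast
    qed
    then have "S \<subseteq> \<Union>\<gamma>" by (rule subsetI)
    moreover have "\<Union>\<gamma> \<subseteq> S" unfolding \<gamma>_def level_set_def by auto
    ultimately show "\<Union>\<gamma> = topspace ?X" by simp
  qed
  moreover have "cover_ord ?X \<gamma> \<le> cover_ord ?X \<alpha> + cover_ord ?X \<beta>"
  proof (rule cover_ord_le)
    show "finite \<gamma>" unfolding \<gamma>_def using finL by simp
    show "topspace ?X \<noteq> {}" using assms(1) by simp
    fix x assume "x \<in> topspace ?X"
    then have x: "x \<in> S" by simp
    let ?Lx = "{L\<in>\<L>. x \<in> level_set S Z h L}"
    let ?a = "card {A\<in>\<alpha>. x \<in> A}" and ?b = "card {B\<in>\<beta>. x \<in> B}"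
    have "{W\<in>\<gamma>. x \<in> W} \<subseteq> level_set S Z h ` ?Lx" unfolding \<gamma>_def by blast
    then have "card {W\<in>\<gamma>. x \<in> W} \<le> card ?Lx"
      by (rule surj_card_le[rotated]) (use finL in simp)
    also have "card ?Lx \<le> card {2..?a + ?b}"
    proof (rule card_inj_on_le)
      show "inj_on card ?Lx"
      proof (rule inj_onI)
        fix L M assume "L \<in> ?Lx" "M \<in> ?Lx" "card L = card M"
        then show "L = M" by (intro level_set_chain[of x S Z h L M] finZ) (simp_all add: \<L>_def)
      qed
      show "card ` ?Lx \<subseteq> {2..?a + ?b}"
      proof
        fix n assume "n \<in> card ` ?Lx"
        then obtain L where L: "L \<in> \<L>" "x \<in> level_set S Z h L" "n = card L" by blast
        then obtain A B where AB: "Inl A \<in> L" "Inr B \<in> L" unfolding \<L>_def by blast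
        have finite_L: "finite L" using L(1) finZ finite_subset unfolding \<L>_def by blast
        have "card {Inl A, Inr B} \<le> card L"
          by (rule card_mono) (use AB finite_L in auto)
        then have "2 \<le> n" using L(3) by simp
        moreover have "L \<subseteq> {A\<in>\<alpha>. x \<in> A} <+> {B\<in>\<beta>. x \<in> B}"
        proof
          fix z assume z: "z \<in> L"
          then have "x \<in> set_of z" using pos L by blast
          moreover have "z \<in> Z" using z L(1) unfolding \<L>_def by blast
          ultimately show "z \<in> {A\<in>\<alpha>. x \<in> A} <+> {B\<in>\<beta>. x \<in> B}"
            unfolding Z_def set_of_def by auto
        qed
        then have "card L \<le> card ({A\<in>\<alpha>. x \<in> A} <+> {B\<in>\<beta>. x \<in> B})"
          by (rule card_mono[rotated]) (use fin in auto)
        then have "n \<le> ?a + ?b"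
          using L(3) fin by (simp add: card_Plus)
        ultimately show "n \<in> {2..?a + ?b}" by simp
      qed
    qed simp
    also have "\<dots> \<le> cover_ord ?X \<alpha> + cover_ord ?X \<beta> + 1"
      using card_le_cover_ord[OF fin(1) \<open>x \<in> topspace ?X\<close>] card_le_cover_ord[OF fin(2) \<open>x \<in> topspace ?X\<close>]
      by simp
    finally show "card {W\<in>\<gamma>. x \<in> W} \<le> cover_ord ?X \<alpha> + cover_ord ?X \<beta> + 1" .
  qed
  ultimately show ?thesis
    using cover_dim_le_cover_ord[of ?X \<gamma> "join_cover \<U> \<V>"] a(3) b(3) by linarith
qed

lemma finite_open_cover_preimage:
  assumes "continuous_map X X f" and "finite_open_cover X \<U>"
  shows "finite_open_cover X (preimage_cover X f \<U>)"
  unfolding finite_open_cover_def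
proof (intro conjI ballI)
  show "finite (preimage_cover X f \<U>)"
    using assms(2) unfolding preimage_cover_def finite_open_cover_def by simp
  show "openin X V" if "V \<in> preimage_cover X f \<U>" for V
    using that assms unfolding preimage_cover_def finite_open_cover_def
    by (auto intro: openin_continuous_map_preimage)
  have "\<Union>(preimage_cover X f \<U>) = {x \<in> topspace X. f x \<in> \<Union>\<U>}"
    unfolding preimage_cover_def by blast
  also have "\<dots> = topspace X"
    using assms unfolding finite_open_cover_def continuous_map_def by auto
  finally show "\<Union>(preimage_cover X f \<U>) = topspace X" .
qed

lemma cover_dim_preimage_le:
  assumes f: "continuous_map X X f" and U: "finite_open_cover X \<U>" and ne: "topspace X \<noteq> {}"
  shows "cover_dim X (preimage_cover X f \<U>) \<le> cover_dim X \<U>"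
proof -
  obtain \<gamma> where g: "finite_open_cover X \<gamma>" "refines_cover \<gamma> \<U>" "cover_ord X \<gamma> = cover_dim X \<U>"
    using cover_dim_attained[OF U] .
  have fin: "finite \<gamma>" using g(1) unfolding finite_open_cover_def by blast
  have "cover_dim X (preimage_cover X f \<U>) \<le> cover_ord X (preimage_cover X f \<gamma>)"
  proof (rule cover_dim_le_cover_ord[OF finite_open_cover_preimage[OF f g(1)]])
    show "refines_cover (preimage_cover X f \<gamma>) (preimage_cover X f \<U>)"
      unfolding refines_cover_def
    proof
      fix V assume "V \<in> preimage_cover X f \<gamma>"
      then obtain G where G: "G \<in> \<gamma>" "V = {x \<in> topspace X. f x \<in> G}"
        unfolding preimage_cover_def by blast
      with g(2) obtain U where "U \<in> \<U>" "G \<subseteq> U" unfolding refines_cover_def by meson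
      then show "\<exists>U\<in>preimage_cover X f \<U>. V \<subseteq> U"
        unfolding preimage_cover_def G(2) by (intro bexI[of _ "{x \<in> topspace X. f x \<in> U}"]) auto
    qed
  qed
  also have "\<dots> \<le> cover_ord X \<gamma>"
  proof (rule cover_ord_le[OF _ ne])
    show "finite (preimage_cover X f \<gamma>)" using fin unfolding preimage_cover_def by simp
    fix x assume x: "x \<in> topspace X"
    have "{V \<in> preimage_cover X f \<gamma>. x \<in> V} \<subseteq> (\<lambda>U. {x \<in> topspace X. f x \<in> U}) ` {U\<in>\<gamma>. f x \<in> U}"
      unfolding preimage_cover_def by blast
    then have "card {V \<in> preimage_cover X f \<gamma>. x \<in> V} \<le> card {U\<in>\<gamma>. f x \<in> U}"
      using fin by (simp add: surj_card_le)
    also have "\<dots> \<le> cover_ord X \<gamma> + 1"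
      using card_le_cover_ord[OF fin] x f by (simp add: continuous_map_def Pi_iff)
    finally show "card {V \<in> preimage_cover X f \<gamma>. x \<in> V} \<le> cover_ord X \<gamma> + 1" .
  qed
  finally show ?thesis using g(3) by simp
qed

lemma finite_open_cover_join:
  assumes "finite_open_cover X \<U>" and "finite_open_cover X \<V>"
  shows "finite_open_cover X (join_cover \<U> \<V>)"
proof -
  have eq: "join_cover \<U> \<V> = (\<lambda>(U, V). U \<inter> V) ` (\<U> \<times> \<V>)"
    unfolding join_cover_def by auto
  have "\<Union>(join_cover \<U> \<V>) = \<Union>\<U> \<inter> \<Union>\<V>"
    unfolding join_cover_def by blast
  then show ?thesis
    using assms unfolding finite_open_cover_def eq by auto
qed

lemma continuous_map_funpow:
  assumes "continuous_map X X f"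
  shows "continuous_map X X (f ^^ n)"
proof (induction n)
  case 0
  show ?case by (simp add: id_def)
next
  case (Suc n)
  then have "continuous_map X X (f \<circ> (f ^^ n))" using assms by (rule continuous_map_compose)
  then show ?case by (simp add: o_def)
qed

lemma finite_open_cover_iter:
  assumes "continuous_map X X f" and "finite_open_cover X \<U>"
  shows "finite_open_cover X (iter_cover X f \<U> n)"
proof (induction n)
  case 0
  show ?case by (simp add: finite_open_cover_def)
next
  case (Suc n)
  then show ?case
    using assms by (simp add: finite_open_cover_join finite_open_cover_preimage continuous_map_funpow)
qed

lemma join_cover_assoc: "join_cover (join_cover \<U> \<V>) \<W> = join_cover \<U> (join_cover \<V> \<W>)"
proof -
  have "join_cover (join_cover \<U> \<V>) \<W> = {(U \<inter> V) \<inter> W |U V W. U \<in> \<U> \<and> V \<in> \<V> \<and> W \<in> \<W>}"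
    unfolding join_cover_def by blast
  also have "\<dots> = {U \<inter> (V \<inter> W) |U V W. U \<in> \<U> \<and> V \<in> \<V> \<and> W \<in> \<W>}"
    by (simp only: Int_assoc)
  also have "\<dots> = join_cover \<U> (join_cover \<V> \<W>)"
    unfolding join_cover_def by blast
  finally show ?thesis .
qed

lemma preimage_cover_join:
  "preimage_cover X f (join_cover \<U> \<V>) = join_cover (preimage_cover X f \<U>) (preimage_cover X f \<V>)"
proof -
  have "preimage_cover X f (join_cover \<U> \<V>) = {{x \<in> topspace X. f x \<in> U \<inter> V} |U V. U \<in> \<U> \<and> V \<in> \<V>}"
    unfolding preimage_cover_def join_cover_def by blast
  also have "\<dots> = {{x \<in> topspace X. f x \<in> U} \<inter> {x \<in> topspace X. f x \<in> V} |U V. U \<in> \<U> \<and> V \<in> \<V>}"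
  proof -
    have "{x \<in> topspace X. f x \<in> U \<inter> V} = {x \<in> topspace X. f x \<in> U} \<inter> {x \<in> topspace X. f x \<in> V}" for U V
      by auto
    then show ?thesis by (simp only:)
  qed
  also have "\<dots> = join_cover (preimage_cover X f \<U>) (preimage_cover X f \<V>)"
    unfolding preimage_cover_def join_cover_def by blast
  finally show ?thesis .
qed

lemma preimage_cover_funpow:
  assumes "\<And>x. x \<in> topspace X \<Longrightarrow> f x \<in> topspace X"
  shows "preimage_cover X (f ^^ m) (preimage_cover X (f ^^ n) \<U>) = preimage_cover X (f ^^ (m + n)) \<U>"
proof -
  have "(f ^^ m) x \<in> topspace X" if "x \<in> topspace X" for x
    using that assms by (induction m) auto
  then have "{x \<in> topspace X. (f ^^ m) x \<in> {x \<in> topspace X. (f ^^ n) x \<in> U}} =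
        {x \<in> topspace X. (f ^^ (m + n)) x \<in> U}" for U
    by (auto simp: add.commute[of m] funpow_add)
  then show ?thesis
    unfolding preimage_cover_def setcompr_eq_image by (simp add: image_image)
qed

lemma iter_cover_add:
  assumes "\<And>x. x \<in> topspace X \<Longrightarrow> f x \<in> topspace X"
  shows "iter_cover X f \<U> (m + n) =
         join_cover (iter_cover X f \<U> m) (preimage_cover X (f ^^ m) (iter_cover X f \<U> n))"
proof (induction n)
  case 0
  have "(f ^^ m) x \<in> topspace X" if "x \<in> topspace X" for x
    using that assms by (induction m) auto
  then have "preimage_cover X (f ^^ m) {topspace X} = {topspace X}"
    unfolding preimage_cover_def by auto
  moreover have "join_cover (iter_cover X f \<U> m) {topspace X} = iter_cover X f \<U> m"
  proof -
    have "U \<inter> topspace X = U" if "U \<in> iter_cover X f \<U> m" for U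
      using that by (cases m) (auto simp: join_cover_def preimage_cover_def)
    then have "(\<lambda>U. U \<inter> topspace X) ` iter_cover X f \<U> m = iter_cover X f \<U> m" by simp
    then show ?thesis unfolding join_cover_def by (auto simp: setcompr_eq_image)
  qed
  ultimately show ?case by simp
next
  case (Suc n)
  then show ?case
    by (simp add: preimage_cover_join preimage_cover_funpow[OF assms] join_cover_assoc)
qed

lemma cover_dim_iter_add_le:
  fixes S :: "'a::metric_space set"
  assumes "S \<noteq> {}" and "continuous_map (top_of_set S) (top_of_set S) f"
    and "finite_open_cover (top_of_set S) \<U>"
  shows "cover_dim (top_of_set S) (iter_cover (top_of_set S) f \<U> (m + n))
         \<le> cover_dim (top_of_set S) (iter_cover (top_of_set S) f \<U> m)
          + cover_dim (top_of_set S) (iter_cover (top_of_set S) f \<U> n)"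
proof -
  let ?X = "top_of_set S"
  have "iter_cover ?X f \<U> (m + n) =
         join_cover (iter_cover ?X f \<U> m) (preimage_cover ?X (f ^^ m) (iter_cover ?X f \<U> n))"
    by (rule iter_cover_add) (use assms(2) in \<open>auto simp: continuous_map_def\<close>)
  moreover have "cover_dim ?X (preimage_cover ?X (f ^^ m) (iter_cover ?X f \<U> n))
      \<le> cover_dim ?X (iter_cover ?X f \<U> n)"
    using assms by (intro cover_dim_preimage_le continuous_map_funpow finite_open_cover_iter) auto
  moreover have "cover_dim ?X (join_cover (iter_cover ?X f \<U> m) (preimage_cover ?X (f ^^ m) (iter_cover ?X f \<U> n)))
     \<le> cover_dim ?X (iter_cover ?X f \<U> m) + cover_dim ?X (preimage_cover ?X (f ^^ m) (iter_cover ?X f \<U> n))"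
    using assms by (intro cover_dim_join_le finite_open_cover_preimage continuous_map_funpow finite_open_cover_iter) auto
  ultimately show ?thesis by simp
qed

text \<open>Fekete's lemma; the limit is the infimum of the averages.\<close>

lemma fekete:
  fixes a :: "nat \<Rightarrow> real"
  assumes nonneg: "\<And>n. 0 \<le> a n" and sub: "\<And>m n. a (m + n) \<le> a m + a n"
  shows "convergent (\<lambda>n. a n / real n)"
proof -
  define l where "l = (INF n\<in>{1..}. a n / real n)"
  have bdd: "bdd_below ((\<lambda>n. a n / real n) ` {1..})"
    by (rule bdd_belowI2[of _ 0]) (use nonneg in auto)
  have mult: "a (q * m + r) \<le> real q * a m + a r" for q m r
  proof (induction q)
    case (Suc q)
    then show ?case using sub[of m "q * m + r"] by (simp add: algebra_simps)
  qed simp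
  have "(\<lambda>n. a n / real n) \<longlonglongrightarrow> l"
  proof (rule tendstoI)
    fix e :: real assume "e > 0"
    then have "l < l + e / 2" by simp
    moreover have "{1::nat..} \<noteq> {}" by simp
    ultimately have "\<exists>m\<in>{1..}. a m / real m < l + e / 2"
      using cINF_less_iff[OF _ bdd, of "l + e / 2"] unfolding l_def[symmetric] by blast
    then obtain m where m: "m \<ge> 1" "a m / real m < l + e / 2" by auto
    define M where "M = (\<Sum>r<m. a r)"
    have "(\<lambda>n. M / real n) \<longlonglongrightarrow> 0" by (rule lim_const_over_n)
    then have "eventually (\<lambda>n. M / real n < e / 2) sequentially"
      using \<open>e > 0\<close> by (intro order_tendstoD) auto
    then show "eventually (\<lambda>n. dist (a n / real n) l < e) sequentially"
      using eventually_ge_at_top[of 1]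
    proof eventually_elim
      case (elim n)
      have "a n \<le> real (n div m) * a m + a (n mod m)"
        using mult[of "n div m" m "n mod m"] by simp
      also have "a (n mod m) \<le> M"
        unfolding M_def by (rule member_le_sum) (use m nonneg in auto)
      also have "real (n div m) \<le> real n / real m" by (rule of_nat_div_le_of_nat)
      finally have "a n \<le> real n / real m * a m + M"
        using nonneg[of m] by (simp add: mult_right_mono)
      then have "a n / real n \<le> (real n / real m * a m + M) / real n"
        by (rule divide_right_mono) simp
      also have "\<dots> = a m / real m + M / real n"
        using elim by (simp add: add_divide_distrib)
      also have "\<dots> < (l + e / 2) + e / 2" by (rule add_strict_mono[OF m(2) elim(1)])
      finally have "a n / real n < l + e" by simp
      moreover have "l \<le> a n / real n"
        unfolding l_def using bdd elim by (intro cINF_lower) auto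
      ultimately show ?case by (simp add: dist_real_def)
    qed
  qed
  then show ?thesis by (rule convergentI)
qed

text \<open>Since the averages converge, a lower bound along a subsequence suffices.\<close>

lemma mdim_cover_ge:
  fixes S :: "'a::metric_space set"
  assumes "S \<noteq> {}" and "continuous_map (top_of_set S) (top_of_set S) f"
    and "finite_open_cover (top_of_set S) \<U>"
    and freq: "\<exists>\<^sub>F n in sequentially. c * real n \<le> real (cover_dim (top_of_set S) (iter_cover (top_of_set S) f \<U> n))"
  shows "c \<le> mdim_cover (top_of_set S) f \<U>"
proof -
  define D where "D n = real (cover_dim (top_of_set S) (iter_cover (top_of_set S) f \<U> n))" for n
  have "convergent (\<lambda>n. D n / real n)"
    by (rule fekete) (use cover_dim_iter_add_le[OF assms(1-3)] in \<open>auto simp: D_def simp flip: of_nat_add\<close>)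
  then have lim: "(\<lambda>n. D n / real n) \<longlonglongrightarrow> mdim_cover (top_of_set S) f \<U>"
    unfolding mdim_cover_def D_def by (simp add: convergent_LIMSEQ_iff)
  show ?thesis
  proof (rule ccontr)
    assume "\<not> ?thesis"
    then have "eventually (\<lambda>n. D n / real n < c) sequentially"
      using lim by (intro order_tendstoD) auto
    then have "eventually (\<lambda>n. \<not> c * real n \<le> D n) sequentially"
      using eventually_gt_at_top[of 0]
      by eventually_elim (simp add: divide_less_eq not_le)
    with freq show False unfolding D_def frequently_def by blast
  qed
qed

text \<open>The form in which the Lebesgue covering theorem is used: apply it to the preimage under \<open>F\<close> of an
  optimal refinement of the cover.\<close>

lemma cover_dim_ge_of_cube:
  fixes F :: "(nat \<Rightarrow> real) \<Rightarrow> 'a::metric_space"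
  assumes W: "finite_open_cover (top_of_set S) \<W>"
    and F: "continuous_on hilbert_cube F" "F ` hilbert_cube \<subseteq> S"
    and faces: "\<And>W m x y. W \<in> \<W> \<Longrightarrow> m < k \<Longrightarrow> x \<in> hilbert_cube \<Longrightarrow> y \<in> hilbert_cube \<Longrightarrow>
        x m = 0 \<Longrightarrow> y m = 1 \<Longrightarrow> F x \<in> W \<Longrightarrow> F y \<in> W \<Longrightarrow> False"
  shows "k \<le> cover_dim (top_of_set S) \<W>"
proof -
  obtain \<gamma> where g: "finite_open_cover (top_of_set S) \<gamma>" "refines_cover \<gamma> \<W>"
    "cover_ord (top_of_set S) \<gamma> = cover_dim (top_of_set S) \<W>"
    using cover_dim_attained[OF W] .
  then have fin: "finite \<gamma>" and un: "\<Union>\<gamma> = S" unfolding finite_open_cover_def by simp_all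
  have "\<exists>H. open H \<and> hilbert_cube \<inter> F -` G = hilbert_cube \<inter> H" if "G \<in> \<gamma>" for G
  proof -
    have "openin (top_of_set S) G" using that g(1) unfolding finite_open_cover_def by blast
    then have "openin (top_of_set hilbert_cube) (hilbert_cube \<inter> F -` G)"
      using continuous_openin_preimage[of hilbert_cube F S G] F by (auto simp: image_subset_iff_funcset)
    then show ?thesis unfolding openin_open by auto
  qed
  then obtain H where H: "\<And>G. G \<in> \<gamma> \<Longrightarrow> open (H G)"
    "\<And>G. G \<in> \<gamma> \<Longrightarrow> hilbert_cube \<inter> F -` G = hilbert_cube \<inter> H G" by metis
  have mem: "q \<in> H G \<longleftrightarrow> F q \<in> G" if "G \<in> \<gamma>" "q \<in> hilbert_cube" for q G
    using H(2)[OF that(1)] that(2) by blast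
  have "\<exists>q\<in>hilbert_cube. k + 1 \<le> card {G\<in>\<gamma>. q \<in> H G}"
  proof (rule cube_covering[OF fin H(1)])
    show "hilbert_cube \<subseteq> (\<Union>G\<in>\<gamma>. H G)"
    proof
      fix q :: "nat \<Rightarrow> real" assume q: "q \<in> hilbert_cube"
      then have "F q \<in> \<Union>\<gamma>" using F(2) un by auto
      then obtain G where "G \<in> \<gamma>" "F q \<in> G" by blast
      then show "q \<in> (\<Union>G\<in>\<gamma>. H G)" using mem q by blast
    qed
    fix G m x y
    assume *: "G \<in> \<gamma>" "m < k" "x \<in> H G \<inter> hilbert_cube" "y \<in> H G \<inter> hilbert_cube" "x m = 0" "y m = 1"
    obtain W where W: "W \<in> \<W>" "G \<subseteq> W" using g(2) *(1) unfolding refines_cover_def by meson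
    have "F x \<in> G" "F y \<in> G" using mem[OF *(1)] *(3,4) by auto
    then have "F x \<in> W" "F y \<in> W" using W(2) by auto
    then show False using faces[of W m x y] W(1) * by simp
  qed
  then obtain q where q: "q \<in> hilbert_cube" "k + 1 \<le> card {G\<in>\<gamma>. q \<in> H G}" by blast
  have "{G\<in>\<gamma>. q \<in> H G} = {G\<in>\<gamma>. F q \<in> G}" using mem q(1) by auto
  moreover have "card {G\<in>\<gamma>. F q \<in> G} \<le> cover_ord (top_of_set S) \<gamma> + 1"
    by (rule card_le_cover_ord[OF fin]) (use F(2) q(1) in auto)
  ultimately show ?thesis using q(2) g(3) by simp
qed

section \<open>Independent words in symbolic systems\<close>

lemma shift_funpow: "(shift ^^ n) x = (\<lambda>m. x (m + int n))"
  by (induction n arbitrary: x) (auto simp: shift_def fun_eq_iff algebra_simps)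

definition occurs_at :: "nat \<Rightarrow> (int \<Rightarrow> 'a) \<Rightarrow> (int \<Rightarrow> 'a) \<Rightarrow> int \<Rightarrow> bool" where
  "occurs_at N x z j \<longleftrightarrow> (\<forall>k. \<bar>k\<bar> \<le> int N \<longrightarrow> z (j + k) = x k)"

lemma occurs_at_shift: "occurs_at N x ((shift ^^ n) z) 0 \<longleftrightarrow> occurs_at N x z (int n)"
  unfolding occurs_at_def shift_funpow by (simp add: add.commute)

lemma open_contains_cylinder:
  fixes z :: "int \<Rightarrow> 'b::topological_space"
  assumes "open W" and "z \<in> W"
  shows "\<exists>N. \<forall>z'. occurs_at N z z' 0 \<longrightarrow> z' \<in> W"
proof -
  have "openin (product_topology (\<lambda>i. euclidean) UNIV) W"
    using assms(1) unfolding open_fun_def .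
  from product_topology_open_contains_basis[OF this assms(2)] obtain B where
    B: "z \<in> PiE UNIV B" "finite {i. B i \<noteq> UNIV}" "PiE UNIV B \<subseteq> W"
    by auto
  define N where "N = nat (\<Sum>i | B i \<noteq> UNIV. \<bar>i\<bar>)"
  have N: "\<bar>i\<bar> \<le> int N" if "B i \<noteq> UNIV" for i
    using member_le_sum[of i "{i. B i \<noteq> UNIV}" abs] that B(2) unfolding N_def by simp
  have "z' \<in> W" if z': "occurs_at N z z' 0" for z'
  proof -
    have "z' i \<in> B i" for i
    proof (cases "B i = UNIV")
      case False
      then have "z' i = z i" using z' N[of i] unfolding occurs_at_def by simp
      then show ?thesis using B(1) by (metis PiE_mem UNIV_I)
    qed simp
    then have "z' \<in> PiE UNIV B" by (simp add: PiE_iff)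
    then show ?thesis using B(3) by blast
  qed
  then show ?thesis by blast
qed

lemma open_occurs_at:
  fixes x :: "int \<Rightarrow> 'b::discrete_topology"
  shows "open {z. occurs_at N x z 0}" and "open {z. \<not> occurs_at N x z 0}"
proof -
  have coord: "open {z::int \<Rightarrow> 'b. z k \<in> A}" for k A
  proof -
    have "open ((\<lambda>z::int \<Rightarrow> 'b. z k) -` A)"
      by (rule open_vimage) (simp_all add: open_discrete)
    then show ?thesis by (simp add: vimage_def)
  qed
  have window: "\<bar>k\<bar> \<le> int N \<longleftrightarrow> k \<in> {- int N..int N}" for k by auto
  have eq: "{z. occurs_at N x z 0} = (\<Inter>k\<in>{- int N..int N}. {z. z k \<in> {x k}})"
    unfolding occurs_at_def by (auto simp: window simp del: atLeastAtMost_iff)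
  show "open {z. occurs_at N x z 0}"
    unfolding eq by (intro open_INT ballI coord finite_atLeastAtMost_int)
  have eq': "{z. \<not> occurs_at N x z 0} = (\<Union>k\<in>{- int N..int N}. {z. z k \<in> - {x k}})"
    unfolding occurs_at_def by (auto simp: window simp del: atLeastAtMost_iff)
  show "open {z. \<not> occurs_at N x z 0}"
    unfolding eq' by (intro open_UN ballI coord)
qed

lemma iter_cover_member:
  assumes "\<And>x. x \<in> topspace X \<Longrightarrow> f x \<in> topspace X" and "A \<in> \<U>" and "B \<in> \<U>"
  shows "{z \<in> topspace X. \<forall>i<n. (f ^^ i) z \<in> (if i \<in> \<omega> then A else B)} \<in> iter_cover X f \<U> n"
proof (induction n)
  case 0
  show ?case by simp
next
  case (Suc n)
  let ?C = "if n \<in> \<omega> then A else B"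
  have "{z \<in> topspace X. \<forall>i<Suc n. (f ^^ i) z \<in> (if i \<in> \<omega> then A else B)} =
     {z \<in> topspace X. \<forall>i<n. (f ^^ i) z \<in> (if i \<in> \<omega> then A else B)} \<inter> {z \<in> topspace X. (f ^^ n) z \<in> ?C}"
    by (auto simp: less_Suc_eq)
  moreover have "{z \<in> topspace X. (f ^^ n) z \<in> ?C} \<in> preimage_cover X (f ^^ n) \<U>"
    unfolding preimage_cover_def using assms(2,3) by auto
  ultimately show ?case using Suc unfolding iter_cover.simps join_cover_def by blast
qed

lemma iter_cover_itinerary:
  assumes "W \<in> iter_cover X f \<U> n" and "j < n"
  shows "\<exists>U\<in>\<U>. \<forall>z\<in>W. (f ^^ j) z \<in> U"
  using assms
proof (induction n arbitrary: W)
  case (Suc n)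
  then obtain W' U where W: "W = W' \<inter> {z \<in> topspace X. (f ^^ n) z \<in> U}" "W' \<in> iter_cover X f \<U> n" "U \<in> \<U>"
    unfolding iter_cover.simps join_cover_def preimage_cover_def by blast
  show ?case
  proof (cases "j = n")
    case True
    then show ?thesis using W(1,3) by (intro bexI[of _ U]) auto
  next
    case False
    then have "j < n" using Suc.prems(2) by simp
    from Suc.IH[OF W(2) this] show ?thesis using W(1) by blast
  qed
qed simp

lemma min_subcover_card_le:
  assumes "\<W> \<subseteq> \<V>" and "finite \<W>" and "topspace X \<subseteq> \<Union>\<W>"
  shows "min_subcover_card X \<V> \<le> card \<W>"
  unfolding min_subcover_card_def using assms by (intro Least_le) blast

lemma standard_cover_of_distinct_words:
  fixes X :: "(int \<Rightarrow> 'b::discrete_topology) set"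
  assumes "x \<in> X" and "y \<in> X" and k: "\<bar>k\<bar> \<le> int N" "x k \<noteq> y k"
  shows "standard_open_cover (top_of_set X) {{z\<in>X. \<not> occurs_at N x z 0}, {z\<in>X. \<not> occurs_at N y z 0}}"
proof -
  have self: "occurs_at N w w 0" for w :: "int \<Rightarrow> 'b" unfolding occurs_at_def by simp
  have disj: "\<not> (occurs_at N x z 0 \<and> occurs_at N y z 0)" for z
    using k unfolding occurs_at_def by (metis add_0)
  define V where "V w = {z\<in>X. \<not> occurs_at N w z 0}" for w
  have V: "openin (top_of_set X) (V w)" for w
    using openin_open_Int[OF open_occurs_at(2)[of N w], of X] unfolding V_def by (simp add: Int_def)
  have nd: "top_of_set X closure_of (V w) \<noteq> X" if "w \<in> X" for w
  proof
    let ?O = "X \<inter> {z. occurs_at N w z 0}"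
    assume "top_of_set X closure_of (V w) = X"
    then have "w \<in> top_of_set X closure_of (V w)" using that by simp
    from this[unfolded in_closure_of, THEN conjunct2, THEN spec, of ?O]
    have "\<exists>z. z \<in> V w \<and> z \<in> ?O"
      using openin_open_Int[OF open_occurs_at(1)[of N w], of X] that self by simp
    then show False unfolding V_def by auto
  qed
  have "V x \<noteq> V y"
  proof -
    have "y \<in> V x" "y \<notin> V y" using assms(2) self[of y] disj[of y] unfolding V_def by auto
    then show ?thesis by metis
  qed
  moreover have "V x \<union> V y = X" using disj unfolding V_def by auto
  ultimately have "standard_open_cover (top_of_set X) {V x, V y}"
    unfolding standard_open_cover_def finite_open_cover_def
    using V nd[OF assms(1)] nd[OF assms(2)] by simp
  then show ?thesis unfolding V_def .
qed

text \<open>A point of the space is read as a partial pattern, whose value at time \<open>i\<close> is 1 if the orbit is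
  outside \<open>A\<close> and 0 if it is outside \<open>B\<close>. A family of patterns avoiding all the points is a subcover of
  the iterated cover. If sets of positive density were not shattered infinitely often, these
  subcovers would have subexponential size, and the entropy would be zero.\<close>

lemma positive_entropy_shatters:
  assumes inv: "\<And>z. z \<in> topspace X \<Longrightarrow> T z \<in> topspace X"
    and disj: "\<And>z. z \<in> topspace X \<Longrightarrow> z \<in> A \<or> z \<in> B"
    and pos: "htop_cover X T {A, B} > 0"
  shows "shatters_positive_density (topspace X) (\<lambda>z i. (T ^^ i) z \<notin> A) (\<lambda>z i. (T ^^ i) z \<notin> B)"
proof (rule ccontr)
  let ?P = "\<lambda>z i. (T ^^ i) z \<notin> A" and ?Q = "\<lambda>z i. (T ^^ i) z \<notin> B"
  let ?Y = "topspace X"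
  let ?N = "\<lambda>n. min_subcover_card X (iter_cover X T {A, B} n)"
  assume no: "\<not> ?thesis"
  have evt: "\<forall>\<^sub>F n in sequentially. \<forall>J\<subseteq>{..<n}. shattered ?Y ?P ?Q J \<longrightarrow> real (card J) \<le> c * real n"
    if "c > 0" for c
  proof -
    have "\<not> (\<exists>\<^sub>F n in sequentially. \<exists>J\<subseteq>{..<n}. c * real n \<le> real (card J) \<and> shattered ?Y ?P ?Q J)"
    proof
      assume "\<exists>\<^sub>F n in sequentially. \<exists>J\<subseteq>{..<n}. c * real n \<le> real (card J) \<and> shattered ?Y ?P ?Q J"
      then have "shatters_positive_density ?Y ?P ?Q"
        unfolding shatters_positive_density_def using that by (intro exI[of _ c] conjI)
      with no show False ..
    qed
    then have "\<forall>\<^sub>F n in sequentially. \<not> (\<exists>J\<subseteq>{..<n}. c * real n \<le> real (card J) \<and> shattered ?Y ?P ?Q J)"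
      unfolding not_frequently .
    then show ?thesis
    proof eventually_elim
      case (elim n)
      show ?case
      proof (intro allI impI)
        fix J assume "J \<subseteq> {..<n}" "shattered ?Y ?P ?Q J"
        with elim have "\<not> c * real n \<le> real (card J)" by auto
        then show "real (card J) \<le> c * real n" by linarith
      qed
    qed
  qed
  have orbit: "(T ^^ i) z \<in> ?Y" if "z \<in> ?Y" for z i
    using that by (induction i) (auto intro: inv)
  have small: "\<forall>\<^sub>F n in sequentially. ln (real (?N n)) / real n \<le> \<epsilon>" if e: "\<epsilon> > 0" for \<epsilon>
  proof -
    obtain c where c: "c > 0" and
      few: "\<And>n S P Q. \<forall>s\<in>S. \<forall>i<n. \<not> (P s i \<and> Q s i) \<Longrightarrow>
      \<forall>J\<subseteq>{..<n}. shattered (S::'a set) P Q J \<longrightarrow> real (card J) \<le> c * real n \<Longrightarrow>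
      \<exists>\<Omega>\<subseteq>Pow {..<n}. real (card \<Omega>) \<le> exp (\<epsilon> * real n) \<and>
         (\<forall>s\<in>S. \<exists>\<omega>\<in>\<Omega>. avoids P Q {..<n} s \<omega>)"
      using few_avoiding_patterns[OF e, where 's='a] by (elim exE conjE) (rule that, assumption, blast)
    show ?thesis
      using evt[OF c] eventually_gt_at_top[of 0]
    proof eventually_elim
      case (elim n)
      have "\<forall>z\<in>?Y. \<forall>i<n. \<not> (?P z i \<and> ?Q z i)"
        using orbit disj by (intro ballI allI impI) simp
      from few[OF this elim(1)] obtain \<Omega> where O: "\<Omega> \<subseteq> Pow {..<n}" "real (card \<Omega>) \<le> exp (\<epsilon> * real n)"
        "\<forall>z\<in>?Y. \<exists>\<omega>\<in>\<Omega>. avoids ?P ?Q {..<n} z \<omega>" by (elim exE conjE) (erule (2) that)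
      have finO: "finite \<Omega>" using O(1) by (rule finite_subset) simp
      define el where "el \<omega> = {z \<in> ?Y. \<forall>i<n. (T ^^ i) z \<in> (if i \<in> \<omega> then A else B)}" for \<omega> :: "nat set"
      have "min_subcover_card X (iter_cover X T {A, B} n) \<le> card (el ` \<Omega>)"
      proof (rule min_subcover_card_le)
        show "el ` \<Omega> \<subseteq> iter_cover X T {A, B} n"
          unfolding el_def by (intro image_subsetI iter_cover_member inv) simp_all
        show "finite (el ` \<Omega>)" using finO by simp
        show "?Y \<subseteq> \<Union>(el ` \<Omega>)"
        proof
          fix z assume z: "z \<in> ?Y"
          then obtain \<omega> where w: "\<omega> \<in> \<Omega>" "avoids ?P ?Q {..<n} z \<omega>" using O(3) by meson
          then have "z \<in> el \<omega>" using z unfolding el_def avoids_def by (auto split: if_splits)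
          then show "z \<in> \<Union>(el ` \<Omega>)" using w(1) by blast
        qed
      qed
      also have "card (el ` \<Omega>) \<le> card \<Omega>" using finO by (rule card_image_le)
      finally have le: "real (?N n) \<le> exp (\<epsilon> * real n)" using O(2) by linarith
      have "ln (real (?N n)) \<le> \<epsilon> * real n"
      proof (cases "?N n = 0")
        case True
        then show ?thesis using e by simp
      next
        case False
        then have "ln (real (?N n)) \<le> ln (exp (\<epsilon> * real n))"
          using le by (subst ln_le_cancel_iff) simp_all
        then show ?thesis by simp
      qed
      then show ?case using elim(2) by (simp add: divide_le_eq)
    qed
  qed
  have "(\<lambda>n. ln (real (?N n)) / real n) \<longlonglongrightarrow> 0"
  proof (rule tendstoI)
    fix \<epsilon> :: real assume "\<epsilon> > 0"
    then have "\<forall>\<^sub>F n in sequentially. ln (real (?N n)) / real n \<le> \<epsilon> / 2" by (intro small) simp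
    then show "\<forall>\<^sub>F n in sequentially. dist (ln (real (?N n)) / real n) 0 < \<epsilon>"
    proof eventually_elim
      case (elim n)
      have "0 \<le> ln (real (?N n))" by (cases "?N n = 0") auto
      then have "0 \<le> ln (real (?N n)) / real n" by simp
      then have "dist (ln (real (?N n)) / real n) 0 = ln (real (?N n)) / real n"
        unfolding dist_real_def by linarith
      then show ?case using elim \<open>\<epsilon> > 0\<close> by linarith
    qed
  qed
  then have "htop_cover X T {A, B} = 0" unfolding htop_cover_def by (rule limI)
  with pos show False by simp
qed

lemma UPE_independence_of_distinct_words:
  fixes X :: "(int \<Rightarrow> nat) set"
  assumes "UPE (top_of_set X) shift" and inv: "shift ` X = X" and x: "x \<in> X" and y: "y \<in> X"
    and k: "\<bar>k\<bar> \<le> int N" "x k \<noteq> y k"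
  shows "shatters_positive_density X (\<lambda>z i. occurs_at N x z (int i)) (\<lambda>z i. occurs_at N y z (int i))"
proof -
  let ?A = "{z\<in>X. \<not> occurs_at N x z 0}" and ?B = "{z\<in>X. \<not> occurs_at N y z 0}"
  have pos: "htop_cover (top_of_set X) shift {?A, ?B} > 0"
    using assms(1) standard_cover_of_distinct_words[OF x y k] unfolding UPE_def by blast
  have "z \<in> ?A \<or> z \<in> ?B" if "z \<in> topspace (top_of_set X)" for z
    using k that unfolding occurs_at_def by (simp, metis add_0)
  from positive_entropy_shatters[OF _ this pos] inv
  have dens: "shatters_positive_density X (\<lambda>z i. (shift ^^ i) z \<notin> ?A) (\<lambda>z i. (shift ^^ i) z \<notin> ?B)"
    by auto
  have orbit: "(shift ^^ i) z \<in> X" if "z \<in> X" for z i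
    using that inv by (induction i) auto
  have "shattered X (\<lambda>z i. occurs_at N x z (int i)) (\<lambda>z i. occurs_at N y z (int i)) J"
    if sh: "shattered X (\<lambda>z i. (shift ^^ i) z \<notin> ?A) (\<lambda>z i. (shift ^^ i) z \<notin> ?B) J" for J
    unfolding shattered_def
  proof (intro allI impI)
    fix \<omega> assume "\<omega> \<subseteq> J"
    then obtain z where z: "z \<in> X" "\<forall>i\<in>J. if i \<in> \<omega> then (shift ^^ i) z \<notin> ?A else (shift ^^ i) z \<notin> ?B"
      using sh unfolding shattered_def by meson
    have "\<forall>i\<in>J. if i \<in> \<omega> then occurs_at N x z (int i) else occurs_at N y z (int i)"
    proof
      fix i assume "i \<in> J"
      with z(2) orbit[OF z(1), of i]
      show "if i \<in> \<omega> then occurs_at N x z (int i) else occurs_at N y z (int i)"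
        by (auto simp: occurs_at_shift split: if_splits)
    qed
    then show "\<exists>z\<in>X. \<forall>i\<in>J. if i \<in> \<omega> then occurs_at N x z (int i) else occurs_at N y z (int i)"
      using z(1) by (rule rev_bexI[rotated])
  qed
  then show ?thesis using dens by (rule shatters_positive_density_mono)
qed

text \<open>Independence also for words that coincide on the window, where it says that the word occurs
  with positive density. If \<open>X\<close> has a further point, the window is enlarged until \<open>x\<close> differs on it
  from that point; if \<open>X\<close> is a singleton, \<open>x\<close> is a fixed point and its word occurs everywhere.\<close>

lemma UPE_independence:
  fixes X :: "(int \<Rightarrow> nat) set"
  assumes upe: "UPE (top_of_set X) shift" and inv: "shift ` X = X" and x: "x \<in> X" and y: "y \<in> X"
  shows "shatters_positive_density X (\<lambda>z i. occurs_at N x z (int i)) (\<lambda>z i. occurs_at N y z (int i))"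
proof (cases "\<exists>k. \<bar>k\<bar> \<le> int N \<and> x k \<noteq> y k")
  case True
  then show ?thesis using UPE_independence_of_distinct_words[OF upe inv x y] by blast
next
  case False
  then have same: "occurs_at N y z j \<longleftrightarrow> occurs_at N x z j" for z j
    unfolding occurs_at_def by metis
  show ?thesis
  proof (cases "X = {x}")
    case True
    with inv have "shift x = x" by auto
    then have "(shift ^^ n) x = x" for n by (induction n) auto
    then have "x (k + int n) = x k" for k n
      using fun_cong[of "(shift ^^ n) x" x k] unfolding shift_funpow by simp
    then have occ: "occurs_at N x x (int n)" for n unfolding occurs_at_def by (metis add.commute)
    have "shattered X (\<lambda>z i. occurs_at N x z (int i)) (\<lambda>z i. occurs_at N y z (int i)) {..<n}" for n
      unfolding shattered_def same using occ x by auto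
    then have "\<exists>J\<subseteq>{..<n}. 1 * real n \<le> real (card J) \<and> shattered X (\<lambda>z i. occurs_at N x z (int i)) (\<lambda>z i. occurs_at N y z (int i)) J" for n
      by (intro exI[of _ "{..<n}"]) simp
    then have "\<exists>\<^sub>F n in sequentially. \<exists>J\<subseteq>{..<n}. 1 * real n \<le> real (card J) \<and> shattered X (\<lambda>z i. occurs_at N x z (int i)) (\<lambda>z i. occurs_at N y z (int i)) J"
      by (intro eventually_frequently always_eventually allI) simp_all
    then show ?thesis
      unfolding shatters_positive_density_def by (intro exI[of _ 1] conjI zero_less_one)
  next
    case False
    then obtain w where w: "w \<in> X" "w \<noteq> x" using x by blast
    then obtain k where k: "x k \<noteq> w k" by (metis ext)
    define M where "M = max N (nat \<bar>k\<bar>)"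
    have "\<bar>k\<bar> \<le> int M" unfolding M_def by simp
    from UPE_independence_of_distinct_words[OF upe inv x w(1) this k]
    have dens: "shatters_positive_density X (\<lambda>z i. occurs_at M x z (int i)) (\<lambda>z i. occurs_at M w z (int i))" .
    have restrict: "occurs_at N x z j" if "occurs_at M x z j" for z j
      using that unfolding occurs_at_def M_def by simp
    have "shattered X (\<lambda>z i. occurs_at N x z (int i)) (\<lambda>z i. occurs_at N y z (int i)) J"
      if sh: "shattered X (\<lambda>z i. occurs_at M x z (int i)) (\<lambda>z i. occurs_at M w z (int i)) J" for J
      unfolding shattered_def same
    proof (intro allI impI)
      fix \<omega> assume "\<omega> \<subseteq> J"
      have "\<exists>z\<in>X. \<forall>i\<in>J. if i \<in> J then occurs_at M x z (int i) else occurs_at M w z (int i)"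
        by (rule shatteredD[OF sh order_refl])
      then obtain z where z: "z \<in> X" "\<And>i. i \<in> J \<Longrightarrow> occurs_at M x z (int i)" by auto
      then show "\<exists>z\<in>X. \<forall>i\<in>J. if i \<in> \<omega> then occurs_at N x z (int i) else occurs_at N x z (int i)"
        using restrict by (intro bexI[of _ z]) simp_all
    qed
    then show ?thesis using dens by (rule shatters_positive_density_mono)
  qed
qed

section \<open>Cubes in the hub-and-spoke system\<close>

lemma sum_separated_windows:
  fixes e :: "nat \<Rightarrow> int" and g :: "nat \<Rightarrow> 'b::comm_monoid_add"
  assumes sep: "\<And>m m'. m < k \<Longrightarrow> m' < k \<Longrightarrow> m \<noteq> m' \<Longrightarrow> int (2 * N + 1) \<le> \<bar>e m - e m'\<bar>"
    and m: "m < k" "\<bar>i - e m\<bar> \<le> int N"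
  shows "(\<Sum>m'<k. if \<bar>i - e m'\<bar> \<le> int N then g m' else 0) = g m"
proof -
  have "(\<Sum>m'<k. if \<bar>i - e m'\<bar> \<le> int N then g m' else 0) = (\<Sum>m'<k. if m' = m then g m' else 0)"
  proof (rule sum.cong[OF refl])
    fix m' assume "m' \<in> {..<k}"
    then have "\<bar>i - e m'\<bar> \<le> int N \<longleftrightarrow> m' = m"
      using sep[of m m'] m by (cases "m' = m") auto
    then show "(if \<bar>i - e m'\<bar> \<le> int N then g m' else 0) = (if m' = m then g m' else 0)" by simp
  qed
  then show ?thesis using m(1) by simp
qed

lemma hub_map_in_Spoke: "x \<in> X \<Longrightarrow> (\<And>i. t i \<in> {0..1}) \<Longrightarrow> hub_map p x t \<in> Spoke p X"
  unfolding Spoke_def by blast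

text \<open>The coordinate \<open>q m\<close> controls the window around \<open>e m\<close>: it shrinks the word of \<open>hub_map p x t\<close> to
  the hub on \<open>[0,1/2]\<close>, and then expands the word of \<open>hub_map p y s\<close> on \<open>[1/2,1]\<close>; outside of the
  windows everything is at the hub. For a given \<open>q\<close>, shattering provides one point \<open>z\<close> of \<open>X\<close> which
  shows the word of \<open>x\<close> where \<open>q m < 1/2\<close> and that of \<open>y\<close> elsewhere; at the hub any symbol of \<open>z\<close> will
  do. The choice of \<open>z\<close> jumps with \<open>q\<close>, but the image point does not.\<close>

lemma cube_through_hub:
  fixes p :: "nat \<Rightarrow> real ^ 2" and X :: "(int \<Rightarrow> nat) set" and e :: "nat \<Rightarrow> nat"
  assumes t: "\<And>i. t i \<in> {0..1}" and s: "\<And>i. s i \<in> {0..1}"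
    and sh: "shattered X (\<lambda>z i. occurs_at N x z (int i)) (\<lambda>z i. occurs_at N y z (int i)) (e ` {..<k})"
    and sep: "\<And>m m'. m < k \<Longrightarrow> m' < k \<Longrightarrow> m \<noteq> m' \<Longrightarrow> int (2 * N + 1) \<le> \<bar>int (e m) - int (e m')\<bar>"
  shows "\<exists>F. continuous_on hilbert_cube F \<and> F ` hilbert_cube \<subseteq> Spoke p X \<and>
      (\<forall>q m. m < k \<longrightarrow> q m = 0 \<longrightarrow> occurs_at N (hub_map p x t) (F q) (int (e m))) \<and>
      (\<forall>q m. m < k \<longrightarrow> q m = 1 \<longrightarrow> occurs_at N (hub_map p y s) (F q) (int (e m)))"
proof -
  define P where "P r = max 0 (1 - 2 * r)" for r :: real
  define Q where "Q r = max 0 (2 * r - 1)" for r :: real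
  define F where "F q = (\<lambda>i. \<Sum>m<k. if \<bar>i - int (e m)\<bar> \<le> int N
      then P (q m) *\<^sub>R hub_map p x t (i - int (e m)) + Q (q m) *\<^sub>R hub_map p y s (i - int (e m)) else 0)"
    for q :: "nat \<Rightarrow> real"
  define T where "T q = (\<lambda>i. \<Sum>m<k. if \<bar>i - int (e m)\<bar> \<le> int N
      then P (q m) * t (i - int (e m)) + Q (q m) * s (i - int (e m)) else 0)"
    for q :: "nat \<Rightarrow> real"
  have F_in: "F q i = P (q m) *\<^sub>R hub_map p x t (i - int (e m)) + Q (q m) *\<^sub>R hub_map p y s (i - int (e m))"
    if "m < k" "\<bar>i - int (e m)\<bar> \<le> int N" for q i m
    unfolding F_def by (rule sum_separated_windows[where e = "\<lambda>m. int (e m)"]) (use sep that in auto)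
  have T_in: "T q i = P (q m) * t (i - int (e m)) + Q (q m) * s (i - int (e m))"
    if "m < k" "\<bar>i - int (e m)\<bar> \<le> int N" for q i m
    unfolding T_def by (rule sum_separated_windows[where e = "\<lambda>m. int (e m)"]) (use sep that in auto)
  have F_out: "F q i = 0" and T_out: "T q i = 0" if "\<not> (\<exists>m<k. \<bar>i - int (e m)\<bar> \<le> int N)" for q i
    unfolding F_def T_def by (rule sum.neutral, use that in auto)+
  have cont: "continuous_on hilbert_cube F"
  proof (rule continuous_on_coordinatewise_then_product)
    fix i
    have coord: "continuous_on hilbert_cube (\<lambda>q::nat \<Rightarrow> real. q m)" for m
      by (rule continuous_on_subset[OF continuous_on_product_coordinates]) simp
    show "continuous_on hilbert_cube (\<lambda>q. F q i)"
      unfolding F_def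
    proof (rule continuous_on_sum)
      fix m
      show "continuous_on hilbert_cube (\<lambda>q. if \<bar>i - int (e m)\<bar> \<le> int N
         then P (q m) *\<^sub>R hub_map p x t (i - int (e m)) + Q (q m) *\<^sub>R hub_map p y s (i - int (e m)) else 0)"
        unfolding P_def Q_def
        by (cases "\<bar>i - int (e m)\<bar> \<le> int N") (auto intro!: continuous_intros coord)
    qed
  qed
  have "F q \<in> Spoke p X" if q: "q \<in> hilbert_cube" for q
  proof -
    let ?\<omega> = "{e m |m. m < k \<and> q m < 1/2}"
    have sub: "?\<omega> \<subseteq> e ` {..<k}" by auto
    have "\<exists>z\<in>X. \<forall>i\<in>e ` {..<k}. if i \<in> ?\<omega> then occurs_at N x z (int i) else occurs_at N y z (int i)"
      by (rule shatteredD[OF sh sub])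
    then obtain z where z: "z \<in> X"
      "\<And>i. i \<in> e ` {..<k} \<Longrightarrow> if i \<in> ?\<omega> then occurs_at N x z (int i) else occurs_at N y z (int i)"
      by blast
    have inj: "m = m'" if "m < k" "m' < k" "e m = e m'" for m m'
      using sep[OF that(1,2)] that(3) by fastforce
    have zx: "occurs_at N x z (int (e m))" if "m < k" "q m < 1/2" for m
      using z(2)[of "e m"] that by (auto split: if_splits)
    have zy: "occurs_at N y z (int (e m))" if "m < k" "\<not> q m < 1/2" for m
    proof -
      have "e m \<notin> ?\<omega>" using inj that by auto
      then show ?thesis using z(2)[of "e m"] that(1) by (simp only: if_False) simp
    qed
    have q01: "0 \<le> q m" "q m \<le> 1" for m using q unfolding hilbert_cube_def by auto
    have PQ: "0 \<le> P (q m)" "P (q m) \<le> 1" "0 \<le> Q (q m)" "Q (q m) \<le> 1"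
      and P0: "\<not> q m < 1/2 \<Longrightarrow> P (q m) = 0" and Q0: "q m < 1/2 \<Longrightarrow> Q (q m) = 0" for m
      using q01[of m] unfolding P_def Q_def by auto
    have "T q i \<in> {0..1} \<and> F q i = T q i *\<^sub>R p (z i)" for i
    proof (cases "\<exists>m<k. \<bar>i - int (e m)\<bar> \<le> int N")
      case False
      then show ?thesis using F_out T_out by simp
    next
      case True
      then obtain m where m: "m < k" "\<bar>i - int (e m)\<bar> \<le> int N" by blast
      let ?j = "i - int (e m)"
      show ?thesis
      proof (cases "q m < 1/2")
        case True
        have "z i = x ?j" using zx[OF m(1) True] m(2) unfolding occurs_at_def by (metis add.commute diff_add_cancel)
        moreover have "P (q m) * t ?j \<in> {0..1}"
          using PQ[of m] t[of ?j] by (auto intro: mult_le_one)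
        ultimately show ?thesis
          unfolding F_in[OF m] T_in[OF m] hub_map_def Q0[OF True] by simp
      next
        case False
        have "z i = y ?j" using zy[OF m(1) False] m(2) unfolding occurs_at_def by (metis add.commute diff_add_cancel)
        moreover have "Q (q m) * s ?j \<in> {0..1}"
          using PQ[of m] s[of ?j] by (auto intro: mult_le_one)
        ultimately show ?thesis
          unfolding F_in[OF m] T_in[OF m] hub_map_def P0[OF False] by simp
      qed
    qed
    then have "F q = hub_map p z (T q)" "\<And>i. T q i \<in> {0..1}" unfolding hub_map_def by auto
    then show ?thesis using hub_map_in_Spoke[OF z(1)] by simp
  qed
  moreover have "occurs_at N (hub_map p x t) (F q) (int (e m))" if "m < k" "q m = 0" for q m
    unfolding occurs_at_def using F_in[OF that(1)] that(2) by (simp add: P_def Q_def)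
  moreover have "occurs_at N (hub_map p y s) (F q) (int (e m))" if "m < k" "q m = 1" for q m
    unfolding occurs_at_def using F_in[OF that(1)] that(2) by (simp add: P_def Q_def)
  ultimately show ?thesis using cont by (intro exI[of _ F]) auto
qed

lemma continuous_on_shift: "continuous_on S (shift :: (int \<Rightarrow> 'a::topological_space) \<Rightarrow> _)"
  unfolding shift_def
  by (intro continuous_on_coordinatewise_then_product continuous_on_subset[OF continuous_on_product_coordinates]) simp

lemma shift_Spoke:
  assumes "shift ` X = X"
  shows "shift ` Spoke p X = Spoke p X"
proof (intro equalityI subsetI)
  fix z assume "z \<in> shift ` Spoke p X"
  then obtain x t where xt: "x \<in> X" "\<And>i. t i \<in> {0..1}" "z = shift (hub_map p x t)"
    unfolding Spoke_def by blast
  have "z = hub_map p (shift x) (shift t)" unfolding xt(3) hub_map_def shift_def by simp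
  moreover have "shift x \<in> X" using assms xt(1) by blast
  ultimately show "z \<in> Spoke p X" using xt(2) hub_map_in_Spoke[of "shift x" X "shift t" p] by (simp add: shift_def)
next
  fix z assume "z \<in> Spoke p X"
  then obtain x t where xt: "x \<in> X" "\<And>i. t i \<in> {0..1}" "z = hub_map p x t"
    unfolding Spoke_def by blast
  then obtain x' where x': "x' \<in> X" "x = shift x'" using assms by blast
  have "z = shift (hub_map p x' (\<lambda>i. t (i - 1)))" unfolding xt(3) x'(2) hub_map_def shift_def by simp
  moreover have "hub_map p x' (\<lambda>i. t (i - 1)) \<in> Spoke p X" using x'(1) xt(2) by (intro hub_map_in_Spoke)
  ultimately show "z \<in> shift ` Spoke p X" by blast
qed

lemma compact_Spoke:
  assumes "compact X"
  shows "compact (Spoke p X)"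
proof -
  have "Spoke p X = (\<lambda>(x, t). hub_map p x t) ` (X \<times> {t. \<forall>i. t i \<in> {0..1}})"
    unfolding Spoke_def by auto
  moreover have "continuous_on (X \<times> {t. \<forall>i. t i \<in> {0..1}}) (\<lambda>(x, t). hub_map p x t)"
  proof -
    have c1: "continuous_on A (\<lambda>w::(int \<Rightarrow> nat) \<times> (int \<Rightarrow> real). snd w i)" for A i
      by (rule continuous_on_product_then_coordinatewise) (intro continuous_intros)
    have c2: "continuous_on A (\<lambda>w::(int \<Rightarrow> nat) \<times> (int \<Rightarrow> real). fst w i)" for A i
      by (rule continuous_on_product_then_coordinatewise) (intro continuous_intros)
    have "continuous_on A (\<lambda>w::(int \<Rightarrow> nat) \<times> (int \<Rightarrow> real). p (fst w i))" for A i
      by (rule continuous_on_compose2[OF _ c2, of UNIV]) simp_all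
    then show ?thesis
      unfolding case_prod_unfold hub_map_def
      by (intro continuous_on_coordinatewise_then_product continuous_on_scaleR c1)
  qed
  ultimately show ?thesis
    using compact_continuous_image compact_Times[OF assms compact_box] by metis
qed

lemma tds_Spoke:
  assumes "compact X" and "shift ` X = X"
  shows "tds (top_of_set (Spoke p X)) shift"
  unfolding tds_def
proof (intro conjI)
  show c: "compact_space (top_of_set (Spoke p X))"
    using compact_Spoke[OF assms(1)] by (simp add: compact_space_subtopology)
  show "metrizable_space (top_of_set (Spoke p X))"
    by (intro metrizable_space_subtopology metrizable_space_euclidean)
  have "inj shift"
    by (rule injI, rule ext) (metis diff_add_cancel shift_def)
  then show "homeomorphic_map (top_of_set (Spoke p X)) (top_of_set (Spoke p X)) shift"
    using shift_Spoke[OF assms(2), of p] c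
    by (intro continuous_imp_homeomorphic_map)
       (auto simp: continuous_on_shift Hausdorff_space_subtopology image_subset_iff_funcset intro: inj_on_subset)
qed

text \<open>A set that is not dense misses a neighbourhood of some point, hence a cylinder about it, and
  one window serves both members of the cover.\<close>

lemma standard_open_cover_misses_cylinders:
  fixes S :: "(int \<Rightarrow> 'b::topological_space) set"
  assumes "standard_open_cover (top_of_set S) \<U>"
  obtains u v U V N where "\<U> = {U, V}" "u \<in> S" "v \<in> S"
    "\<And>z. z \<in> U \<Longrightarrow> \<not> occurs_at N u z 0" "\<And>z. z \<in> V \<Longrightarrow> \<not> occurs_at N v z 0"
proof -
  obtain U V where UV: "\<U> = {U, V}"
    using assms unfolding standard_open_cover_def by (meson card_2_iff)
  have "\<exists>u N. u \<in> S \<and> (\<forall>z\<in>W. \<not> occurs_at N u z 0)" if "W \<in> \<U>" for W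
  proof -
    have "openin (top_of_set S) W" "top_of_set S closure_of W \<noteq> S"
      using assms that unfolding standard_open_cover_def finite_open_cover_def by auto
    then have "W \<subseteq> S" using openin_imp_subset by blast
    have "top_of_set S closure_of W \<subseteq> S" using closure_of_subset_topspace[of "top_of_set S" W] by simp
    with \<open>top_of_set S closure_of W \<noteq> S\<close> obtain u where u: "u \<in> S" "u \<notin> top_of_set S closure_of W" by blast
    then obtain O' where O': "u \<in> O'" "openin (top_of_set S) O'" "\<not> (\<exists>y. y \<in> W \<and> y \<in> O')"
      unfolding in_closure_of by auto
    then obtain G where G: "open G" "O' = S \<inter> G" unfolding openin_open by blast
    then obtain N where "\<forall>z. occurs_at N u z 0 \<longrightarrow> z \<in> G"
      using open_contains_cylinder[of G u] O'(1) by blast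
    then have "\<forall>z\<in>W. \<not> occurs_at N u z 0" using O'(3) G(2) \<open>W \<subseteq> S\<close> by blast
    then show ?thesis using u(1) by blast
  qed
  then have ex: "\<And>W. W \<in> \<U> \<Longrightarrow> \<exists>u N. u \<in> S \<and> (\<forall>z\<in>W. \<not> occurs_at N u z 0)" .
  obtain u M where u: "u \<in> S" "\<forall>z\<in>U. \<not> occurs_at M u z 0"
    using ex[of U] UV by auto
  obtain v M' where v: "v \<in> S" "\<forall>z\<in>V. \<not> occurs_at M' v z 0"
    using ex[of V] UV by auto
  have max: "occurs_at M w z 0 \<and> occurs_at M' w z 0" if "occurs_at (max M M') w z 0" for w z :: "int \<Rightarrow> 'b"
    using that unfolding occurs_at_def by simp
  show ?thesis
  proof (rule that[OF UV u(1) v(1), of "max M M'"])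
    show "\<not> occurs_at (max M M') u z 0" if "z \<in> U" for z using u(2) max[of u z] that by auto
    show "\<not> occurs_at (max M M') v z 0" if "z \<in> V" for z using v(2) max[of v z] that by auto
  qed
qed

theorem theorem1p5:
  fixes a :: nat and p :: "nat \<Rightarrow> real ^ 2" and X :: "(int \<Rightarrow> nat) set"
  assumes "a \<ge> 1"
    and "\<forall>j\<in>{1..a}. p j \<in> sphere 0 1"
    and "inj_on p {1..a}"
    and "\<forall>x\<in>X. \<forall>i. x i \<in> {1..a}"
    and "closed X"
    and "shift ` X = X"
    and "UPE (top_of_set X) shift"
  shows "UPMD (top_of_set (Spoke p X)) shift"
  unfolding UPMD_def
proof (intro conjI allI impI)
  have "compact X"
  proof -
    have "compact_space (top_of_set X)" using assms(7) unfolding UPE_def tds_def by (elim conjE)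
    then have "compactin euclidean X" unfolding compactin_subspace by simp
    then show ?thesis by simp
  qed
  then show "tds (top_of_set (Spoke p X)) shift" using assms(6) by (rule tds_Spoke)
  fix \<U> assume std: "standard_open_cover (top_of_set (Spoke p X)) \<U>"
  let ?S = "Spoke p X"
  obtain u v U V N where UV: "\<U> = {U, V}" "u \<in> ?S" "v \<in> ?S"
    "\<And>z. z \<in> U \<Longrightarrow> \<not> occurs_at N u z 0" "\<And>z. z \<in> V \<Longrightarrow> \<not> occurs_at N v z 0"
    by (rule standard_open_cover_misses_cylinders[OF std]) (rule that; assumption)
  obtain x t where x: "x \<in> X" "\<And>i. t i \<in> {0..1}" "u = hub_map p x t"
    using UV(2) unfolding Spoke_def by blast
  obtain y s where y: "y \<in> X" "\<And>i. s i \<in> {0..1}" "v = hub_map p y s"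
    using UV(3) unfolding Spoke_def by blast
  obtain c where c: "c > 0" "\<exists>\<^sub>F n in sequentially. \<exists>J\<subseteq>{..<n}. c * real n \<le> real (card J) \<and>
           shattered X (\<lambda>z i. occurs_at N x z (int i)) (\<lambda>z i. occurs_at N y z (int i)) J"
    using UPE_independence[OF assms(7,6) x(1) y(1), of N] unfolding shatters_positive_density_def by (elim exE conjE) (erule (1) that)
  have cover: "finite_open_cover (top_of_set ?S) \<U>" using std unfolding standard_open_cover_def by blast
  have map: "continuous_map (top_of_set ?S) (top_of_set ?S) shift"
    using shift_Spoke[OF assms(6), of p] by (auto simp: continuous_on_shift)
  have dim: "c / real (2 * N + 1) * real n \<le> real (cover_dim (top_of_set ?S) (iter_cover (top_of_set ?S) shift \<U> n))"
    if J: "J \<subseteq> {..<n}" "c * real n \<le> real (card J)"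
      "shattered X (\<lambda>z i. occurs_at N x z (int i)) (\<lambda>z i. occurs_at N y z (int i)) J" for n J
  proof -
    have "finite J" using J(1) finite_subset by blast
    from separated_subset[OF this, of "2 * N + 1"] obtain K where K: "K \<subseteq> J" "card J \<le> (2 * N + 1) * card K"
      "\<forall>i\<in>K. \<forall>j\<in>K. i \<noteq> j \<longrightarrow> int (2 * N + 1) \<le> \<bar>int i - int j\<bar>" by auto
    have "finite K" using K(1) \<open>finite J\<close> finite_subset by blast
    then obtain e where e: "bij_betw e {..<card K} K"
      using ex_bij_betw_nat_finite by (metis atLeast0LessThan)
    have im: "e ` {..<card K} = K" using e by (rule bij_betw_imp_surj_on)
    have sep: "int (2 * N + 1) \<le> \<bar>int (e m) - int (e m')\<bar>" if "m < card K" "m' < card K" "m \<noteq> m'" for m m'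
    proof -
      have "e m \<noteq> e m'" using bij_betw_imp_inj_on[OF e] that by (auto dest: inj_onD)
      moreover have "e m \<in> K" "e m' \<in> K" using im that by auto
      ultimately show ?thesis using K(3) by blast
    qed
    have sh: "shattered X (\<lambda>z i. occurs_at N x z (int i)) (\<lambda>z i. occurs_at N y z (int i)) (e ` {..<card K})"
      unfolding im using J(3) K(1) by (rule shattered_subset)
    have "\<exists>F. continuous_on hilbert_cube F \<and> F ` hilbert_cube \<subseteq> ?S \<and>
      (\<forall>q m. m < card K \<longrightarrow> q m = 0 \<longrightarrow> occurs_at N u (F q) (int (e m))) \<and>
      (\<forall>q m. m < card K \<longrightarrow> q m = 1 \<longrightarrow> occurs_at N v (F q) (int (e m)))"
      unfolding x(3) y(3) by (rule cube_through_hub) (rule x(2) y(2) sh sep; assumption)+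
    then obtain F where F: "continuous_on hilbert_cube F" "F ` hilbert_cube \<subseteq> ?S"
      and F0: "\<forall>q m. m < card K \<longrightarrow> q m = 0 \<longrightarrow> occurs_at N u (F q) (int (e m))"
      and F1: "\<forall>q m. m < card K \<longrightarrow> q m = 1 \<longrightarrow> occurs_at N v (F q) (int (e m))"
      by (elim exE conjE) (rule that; assumption)
    have "card K \<le> cover_dim (top_of_set ?S) (iter_cover (top_of_set ?S) shift \<U> n)"
    proof (rule cover_dim_ge_of_cube[OF finite_open_cover_iter[OF map cover] F(1,2)])
      fix W m q q'
      assume W: "W \<in> iter_cover (top_of_set ?S) shift \<U> n" and m: "m < card K"
        and q: "q m = 0" "q' m = 1" "F q \<in> W" "F q' \<in> W"
      have "e m \<in> K" using im m by blast
      then have "e m < n" using K(1) J(1) by blast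
      from iter_cover_itinerary[OF W this] obtain G where
        G: "G \<in> \<U>" "(shift ^^ e m) (F q) \<in> G" "(shift ^^ e m) (F q') \<in> G" using q(3,4) by blast
      have "occurs_at N u ((shift ^^ e m) (F q)) 0" "occurs_at N v ((shift ^^ e m) (F q')) 0"
        unfolding occurs_at_shift using F0 F1 m q(1,2) by simp_all
      then show False using G UV(1,4,5) by auto
    qed
    then have "card J \<le> (2 * N + 1) * cover_dim (top_of_set ?S) (iter_cover (top_of_set ?S) shift \<U> n)"
      by (intro order_trans[OF K(2)] mult_le_mono2)
    then have "real (card J) \<le> real ((2 * N + 1) * cover_dim (top_of_set ?S) (iter_cover (top_of_set ?S) shift \<U> n))"
      by (rule of_nat_mono)
    with J(2) have "c * real n \<le> real (cover_dim (top_of_set ?S) (iter_cover (top_of_set ?S) shift \<U> n)) * real (2 * N + 1)"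
      unfolding of_nat_mult[of "2 * N + 1"] mult.commute[of "real (2 * N + 1)"] by (rule order_trans)
    then have "c * real n / real (2 * N + 1) \<le> real (cover_dim (top_of_set ?S) (iter_cover (top_of_set ?S) shift \<U> n))"
      by (subst pos_divide_le_eq) simp_all
    then show ?thesis by (simp only: times_divide_eq_left)
  qed
  have "c / real (2 * N + 1) \<le> mdim_cover (top_of_set ?S) shift \<U>"
  proof (rule mdim_cover_ge[OF _ map cover])
    show "?S \<noteq> {}" using UV(2) by blast
    show "\<exists>\<^sub>F n in sequentially. c / real (2 * N + 1) * real n
        \<le> real (cover_dim (top_of_set ?S) (iter_cover (top_of_set ?S) shift \<U> n))"
      using c(2) by (rule frequently_elim1) (elim exE conjE, rule dim)
  qed
  moreover have "0 < c / real (2 * N + 1)" using c(1) by simp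
  ultimately show "mdim_cover (top_of_set ?S) shift \<U> > 0" by linarith
qed

end
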